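(* Let $m\in\mathbb{Z}^+$ with $m\ge 5$. Then $G(m,2)$ has metamour limit period $2$. The metamour limit set of $G(m,2)$ consists of the two graphs $(V(G(m,2)),\operatorname{FM}_{ev}(G(m,2)))$ and $(V(G(m,2)),\operatorname{FM}_{od}(G(m,2)))$, where $\operatorname{FM}_{ev}(G(m,2))$ and $\operatorname{FM}_{od}(G(m,2))$ stabilize by $2\lfloor m/2\rfloor+m-8$. Moreover, \[ \operatorname{FM}_{ev}(G(m,2))=E(\operatorname{M}^{2\ell}(G(m,2))) \quad\text{and}\quad \operatorname{FM}_{od}(G(m,2))=E(\operatorname{M}^{2\ell+1}(G(m,2))) \] for all sufficiently large $\ell\in\mathbb{N}$. Finally, \[ \operatorname{FM}_{ev}(G(m,2))\cup\operatorname{FM}_{od}(G(m,2))=E(G(m,2))\cup E(\overline{G(m,2)}). \]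
   Context: $\mathbb{N}$ denotes the nonnegative integers and $\mathbb{Z}^+$ the positive integers. $V(G)$ and $E(G)$ are the vertex and edge sets of a graph $G$, and $\overline{G}$ is the complement of $G$. The metamour graph $\operatorname{M}(G)$ of a finite simple graph $G$ has vertex set $V(G)$, with $x,y$ adjacent iff $d_G(x,y)=2$ (graph distance); $\operatorname{M}^0(G)=G$, $\operatorname{M}^{k+1}(G)=\operatorname{M}(\operatorname{M}^k(G))$. $G$ has metamour limit period $k\in\mathbb{Z}^+$ if there is $N\in\mathbb{N}$ such that $\operatorname{M}^{k+i}(G)=\operatorname{M}^i(G)$ (as labeled graphs) for all integers $i\ge N$, and $k$ is minimal with this property; the metamour limit set is then $\{\operatorname{M}^i(G)\mid i\ge N\}$. Generalized Petersen graph $G(m,j)$ ($m,j\in\mathbb{Z}^+$, $m\ge5$, $1\le j<m/2$): vertices $v_i,u_i$ for $0\le i<m$, edges $v_iv_{i+1}$, $v_iu_i$, $u_iu_{i+j}$ for all $0\le i<m$, indices modulo $m$. 2-walks: let $G=(V,E)$, $u\ne v$ in $V$, $k\in\mathbb{Z}^+$. A 2-walk of length $k$ from $u$ to $v$ is a walk $\pi=(w_0,w_1,\dots,w_{2^k})$ in $G$ (consecutive vertices adjacent) with $w_0=u$, $w_{2^k}=v$ such that (1) for all $0\le i\le k-1$ and $0\le j\le 2^{k-i-1}-1$, the vertices $w_{2j\cdot2^i}$, $w_{(2j+1)\cdot2^i}$, $w_{2(j+1)\cdot2^i}$ are distinct; and (2) for all $0\le j\le 2^{k-1}-1$, $w_{2j}w_{2(j+1)}\notin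 E$. It is fully minimal if, for all $1\le i\le k-1$ and $0\le j\le 2^{k-i-1}-1$, there is no 2-walk of length $i$ from $w_{j\cdot2^{i+1}}$ to $w_{(j+1)\cdot2^{i+1}}$ in $G$. For $k\in\mathbb{Z}^+$, $\operatorname{FM}_k(G(m,2))\subseteq E(G(m,2))\cup E(\overline{G(m,2)})$ is the set of all edges (unordered pairs) $uv$ with distinct $u,v\in V(G(m,2))$ for which there exists a fully minimal 2-walk of length $k$ from $u$ to $v$ in $G(m,2)$. Put $\operatorname{FM}_{ev}(G(m,2))=\bigcup_{k\text{ even}}\operatorname{FM}_k(G(m,2))$ and $\operatorname{FM}_{od}(G(m,2))=\bigcup_{k\text{ odd}}\operatorname{FM}_k(G(m,2))$ (over positive integers $k$). $\operatorname{FM}_{ev}(G(m,2))$ stabilizes by $N\in\mathbb{Z}^+$ if $\operatorname{FM}_{ev}(G(m,2))=\bigcup_{k\text{ even},\,k\le N}\operatorname{FM}_k(G(m,2))$; similarly $\operatorname{FM}_{od}(G(m,2))$ stabilizes by $N$ if $\operatorname{FM}_{od}(G(m,2))=\bigcup_{k\text{ odd},\,k\le N}\operatorname{FM}_k(G(m,2))$. Such an $N$ is not unique.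
   Formalization: For m=5 the stated bound 2⌊m/2⌋+m−8=1 is false for FM_ev, since FM_2(G(5,2)) is nonempty (v0,v4,v3,v2,v1 is a fully minimal 2-walk); there FM_ev is instead shown to stabilize by 2. All else is as stated. *)

theory Defs
  imports Complex_Main "HOL-Library.Extended_Nat"
begin

text \<open>A graph is a pair of a vertex set and a set of edges, each edge being an unordered pair
  \<open>{x, y}\<close>. Equality of such pairs is equality of labeled graphs.\<close>

type_synonym 'a ugraph = "'a set \<times> 'a set set"

abbreviation verts :: "'a ugraph \<Rightarrow> 'a set" where "verts \<equiv> fst"
abbreviation edges :: "'a ugraph \<Rightarrow> 'a set set" where "edges \<equiv> snd"

definition graph_complement :: "'a ugraph \<Rightarrow> 'a ugraph" where
  "graph_complement G =
     (verts G, {{x, y} | x y. x \<in> verts G \<and> y \<in> verts G \<and> x \<noteq> y \<and> {x, y} \<notin> edges G})"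

text \<open>A walk is the list of its vertices, so a walk with \<open>n\<close> edges has list length \<open>n + 1\<close>.\<close>

definition walk :: "'a ugraph \<Rightarrow> 'a list \<Rightarrow> bool" where
  "walk G w \<longleftrightarrow> w \<noteq> [] \<and> set w \<subseteq> verts G \<and>
     (\<forall>i. Suc i < length w \<longrightarrow> {w ! i, w ! Suc i} \<in> edges G)"

text \<open>The infimum of the empty set in \<open>enat\<close> is \<open>\<infinity>\<close>, the distance of vertices in different
  components.\<close>

definition gdist :: "'a ugraph \<Rightarrow> 'a \<Rightarrow> 'a \<Rightarrow> enat" where
  "gdist G u v = Inf {enat n | n. \<exists>w. walk G w \<and> length w = n + 1 \<and> hd w = u \<and> last w = v}"

definition metamour :: "'a ugraph \<Rightarrow> 'a ugraph" where
  "metamour G = (verts G, {{x, y} | x y. x \<in> verts G \<and> y \<in> verts G \<and> gdist G x y = 2})"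

definition metamour_periodic_from :: "'a ugraph \<Rightarrow> nat \<Rightarrow> nat \<Rightarrow> bool" where
  "metamour_periodic_from G k N \<longleftrightarrow>
     (\<forall>i\<ge>N. (metamour ^^ (k + i)) G = (metamour ^^ i) G)"

definition has_metamour_limit_period :: "'a ugraph \<Rightarrow> nat \<Rightarrow> bool" where
  "has_metamour_limit_period G k \<longleftrightarrow>
     0 < k \<and> (\<exists>N. metamour_periodic_from G k N) \<and>
     (\<forall>k'. 0 < k' \<and> (\<exists>N. metamour_periodic_from G k' N) \<longrightarrow> k \<le> k')"

text \<open>The set \<open>{M\<^sup>i(G) | i \<ge> N}\<close> does not depend on the choice of \<open>N\<close>.\<close>

definition is_metamour_limit_set :: "'a ugraph \<Rightarrow> 'a ugraph set \<Rightarrow> bool" where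
  "is_metamour_limit_set G S \<longleftrightarrow>
     (\<exists>k N. has_metamour_limit_period G k \<and> metamour_periodic_from G k N \<and>
        S = {(metamour ^^ i) G | i. N \<le> i})"

text \<open>\<open>Outer i\<close> and \<open>Inner i\<close> are the vertices usually written $v_i$ and $u_i$.\<close>

datatype pvertex = Outer nat | Inner nat

definition gen_petersen :: "nat \<Rightarrow> nat \<Rightarrow> pvertex ugraph" where
  "gen_petersen m j =
     (Outer ` {..<m} \<union> Inner ` {..<m},
      {{Outer i, Outer ((i + 1) mod m)} | i. i < m} \<union>
      {{Outer i, Inner i} | i. i < m} \<union>
      {{Inner i, Inner ((i + j) mod m)} | i. i < m})"

definition two_walk :: "'a ugraph \<Rightarrow> nat \<Rightarrow> 'a \<Rightarrow> 'a \<Rightarrow> 'a list \<Rightarrow> bool" where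
  "two_walk G k u v w \<longleftrightarrow>
     0 < k \<and> u \<noteq> v \<and> walk G w \<and> length w = 2 ^ k + 1 \<and> w ! 0 = u \<and> w ! (2 ^ k) = v \<and>
     (\<forall>i<k. \<forall>j<2 ^ (k - i - 1).
        distinct [w ! (2 * j * 2 ^ i), w ! ((2 * j + 1) * 2 ^ i), w ! (2 * (j + 1) * 2 ^ i)]) \<and>
     (\<forall>j<2 ^ (k - 1). {w ! (2 * j), w ! (2 * (j + 1))} \<notin> edges G)"

definition fully_minimal_two_walk :: "'a ugraph \<Rightarrow> nat \<Rightarrow> 'a \<Rightarrow> 'a \<Rightarrow> 'a list \<Rightarrow> bool" where
  "fully_minimal_two_walk G k u v w \<longleftrightarrow>
     two_walk G k u v w \<and>
     (\<forall>i\<in>{1..k - 1}. \<forall>j<2 ^ (k - i - 1).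
        \<not> (\<exists>w'. two_walk G i (w ! (j * 2 ^ (i + 1))) (w ! ((j + 1) * 2 ^ (i + 1))) w'))"

definition FM :: "'a ugraph \<Rightarrow> nat \<Rightarrow> 'a set set" where
  "FM G k = {{u, v} | u v. u \<in> verts G \<and> v \<in> verts G \<and> u \<noteq> v \<and>
     (\<exists>w. fully_minimal_two_walk G k u v w)}"

definition FM_ev :: "'a ugraph \<Rightarrow> 'a set set" where
  "FM_ev G = (\<Union>k\<in>{k. 0 < k \<and> even k}. FM G k)"

definition FM_od :: "'a ugraph \<Rightarrow> 'a set set" where
  "FM_od G = (\<Union>k\<in>{k. 0 < k \<and> odd k}. FM G k)"

definition FM_ev_stabilizes_by :: "'a ugraph \<Rightarrow> nat \<Rightarrow> bool" where
  "FM_ev_stabilizes_by G N \<longleftrightarrow>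
     0 < N \<and> FM_ev G = (\<Union>k\<in>{k. 0 < k \<and> even k \<and> k \<le> N}. FM G k)"

definition FM_od_stabilizes_by :: "'a ugraph \<Rightarrow> nat \<Rightarrow> bool" where
  "FM_od_stabilizes_by G N \<longleftrightarrow>
     0 < N \<and> FM_od G = (\<Union>k\<in>{k. 0 < k \<and> odd k \<and> k \<le> N}. FM G k)"

text \<open>For the Petersen graph $G(5,2)$ the number $2 \lfloor m/2 \rfloor + m - 8$ is $1$, which is too
  small for \<open>FM_ev\<close>: no positive even number is at most $1$, but the path
  $v_0, v_4, v_3, v_2, v_1$ is a fully minimal 2-walk of length 2. Hence the bound is
  stated for \<open>FM_ev\<close> with the value $2$ instead of $1$ when $m = 5$.\<close>

lemma not_FM_ev_stabilizes_petersen: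
  "\<not> FM_ev_stabilizes_by (gen_petersen 5 2) (2 * (5 div 2) + 5 - 8)"
proof -
  let ?G = "gen_petersen 5 2"
  let ?w = "[Outer 0, Outer 4, Outer 3, Outer 2, Outer 1]"
  have edge_iff: "{Outer a, Outer b} \<in> edges ?G \<longleftrightarrow>
      a < 5 \<and> b = (a + 1) mod 5 \<or> b < 5 \<and> a = (b + 1) mod 5" for a b
    by (auto simp: gen_petersen_def doubleton_eq_iff)
  have verts: "Outer a \<in> verts ?G \<longleftrightarrow> a < 5" for a
    by (auto simp: gen_petersen_def)
  have walk: "walk ?G ?w"
    by (auto simp: walk_def verts edge_iff less_Suc_eq)
  have two: "two_walk ?G 2 (Outer 0) (Outer 1) ?w"
    using walk by (auto simp: two_walk_def edge_iff less_2_cases_iff)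
  have no_one: "\<not> two_walk ?G 1 (Outer 0) (Outer 1) w" for w
    by (auto simp: two_walk_def edge_iff)
  have "fully_minimal_two_walk ?G 2 (Outer 0) (Outer 1) ?w"
    using two no_one by (simp add: fully_minimal_two_walk_def)
  then have "{Outer 0, Outer 1} \<in> FM ?G 2"
    unfolding FM_def mem_Collect_eq using verts[of 0] verts[of 1]
    by (intro exI[of _ "Outer 0"] exI[of _ "Outer 1"] conjI exI[of _ ?w]) simp_all
  then have "{Outer 0, Outer 1} \<in> FM_ev ?G"
    unfolding FM_ev_def by (auto intro!: bexI[of _ 2] exI[of _ 2])
  moreover have "{k::nat. 0 < k \<and> even k \<and> k \<le> 2 * (5 div 2) + 5 - 8} = {}"
    by (auto elim!: evenE)
  ultimately show ?thesis
    by (simp only: FM_ev_stabilizes_by_def UN_empty) auto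
qed

end

theory Submission
  imports Defs
begin

text \<open>
  Cutting a 2-walk in the middle turns both notions of 2-walk into recursions on relations. Let
  \<open>W\<^sub>k\<close> be the relation of being the ends of a 2-walk of length \<open>k\<close>, and \<open>F\<^sub>k\<close> the same for fully
  minimal 2-walks. Then \<open>W\<^sub>1 = F\<^sub>1\<close>, two distinct vertices are in \<open>W\<^bsub>k+1\<^esub>\<close> iff they have a common
  \<open>W\<^sub>k\<close>-neighbour, and they are in \<open>F\<^bsub>k+1\<^esub>\<close> iff they have a common \<open>F\<^sub>k\<close>-neighbour and are not in
  \<open>W\<^sub>k\<close> (\<open>joined_Suc\<close>, \<open>min_joined_Suc\<close>). On the other side, two distinct vertices are
  adjacent in the next metamour graph iff they are not adjacent in the present one and have a common
  neighbour there (\<open>edge_metamour_iff\<close>).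

  Suppose that the ends of every edge of \<open>G\<close> have a common neighbour in the metamour graph of \<open>G\<close>.
  Then a pair in \<open>F\<^sub>k\<close> is adjacent in all the iterates \<open>k, k + 2, k + 4, \<dots>\<close>
  (\<open>min_joined_persists\<close>): its common \<open>F\<^bsub>k-1\<^esub>\<close>-neighbour is by induction a common neighbour in the
  iterates \<open>k - 1, k + 1, \<dots>\<close>, and adjacency in one iterate excludes adjacency in the next, so
  the pair has to reappear at every second step. Consequently no pair belongs to \<open>F\<^sub>k\<close> and \<open>F\<^sub>l\<close> with
  \<open>k\<close> and \<open>l\<close> of different parity. If moreover every pair of distinct vertices belongs to some
  \<open>F\<^sub>k\<close> with \<open>k \<le> N\<close>, then from the iterate \<open>N\<close> on the even and the odd iterates are two fixed
  complementary graphs, with edge sets the unions of the \<open>F\<^sub>k\<close> over even and over odd \<open>k\<close>, and the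
  whole theorem follows for \<open>G\<close> with the bound \<open>N\<close>.

  It remains to place every pair of vertices of \<open>G(m,2)\<close> into some \<open>F\<^sub>k\<close>. Vertices are indexed by
  integers modulo \<open>m\<close>, and a pair is described by the types of its ends and the difference of their
  indices, its shift. With \<open>c = 2\<^sup>k - 4\<close> (\<open>k \<ge> 3\<close>), the pairs in \<open>W\<^bsub>k-1\<^esub>\<close> have shifts of absolute value
  at most \<open>c\<close> (outer--outer), at most \<open>c + 2\<close> (mixed), and at most \<open>c\<close> or equal to \<open>c + 4\<close>
  (inner--inner); the next step replaces \<open>c\<close> by \<open>2c + 4\<close>. All shifts that are new in this step and
  at most \<open>m/2\<close> are sums of two shifts that were new in the step before (\<open>new_shift_split\<close>), so
  they are in \<open>F\<^sub>k\<close>. Together with the edges, which are in \<open>F\<^sub>2\<close>, and the pairs at distance two,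
  which are in \<open>F\<^sub>1\<close>, the new shifts of all steps exhaust the range up to \<open>m/2\<close>. So every pair is
  reached, after a number of steps that is only logarithmic in \<open>m\<close>.
\<close>

section \<open>Two-walks as iterated composition\<close>

definition joined :: "'a ugraph \<Rightarrow> nat \<Rightarrow> 'a \<Rightarrow> 'a \<Rightarrow> bool" where
  "joined G k u v \<longleftrightarrow> (\<exists>w. two_walk G k u v w)"

definition min_joined :: "'a ugraph \<Rightarrow> nat \<Rightarrow> 'a \<Rightarrow> 'a \<Rightarrow> bool" where
  "min_joined G k u v \<longleftrightarrow> (\<exists>w. fully_minimal_two_walk G k u v w)"

lemma two_walk_ends:
  assumes "two_walk G k u v w"
  shows "length w = 2 ^ k + 1" "w ! 0 = u" "w ! (2 ^ k) = v"
  using assms unfolding two_walk_def by blast+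

lemma fully_minimal_imp_two_walk: "fully_minimal_two_walk G k u v w \<Longrightarrow> two_walk G k u v w"
  unfolding fully_minimal_two_walk_def by blast

lemma all_less_double:
  fixes n :: nat
  shows "(\<forall>j<2 * n. P j) \<longleftrightarrow> (\<forall>j<n. P j) \<and> (\<forall>j<n. P (n + j))"
proof (intro iffI conjI allI impI)
  fix j assume "(\<forall>j<n. P j) \<and> (\<forall>j<n. P (n + j))" "j < 2 * n"
  then show "P j"
    by (cases "j < n") (auto dest: spec[of _ "j - n"])
qed auto

lemma walk_split:
  assumes "length w = 2 * n + 1"
  shows "walk G w \<longleftrightarrow> walk G (take (n + 1) w) \<and> walk G (drop n w)"
proof -
  have "(\<forall>i. Suc i < length w \<longrightarrow> {w ! i, w ! Suc i} \<in> edges G) \<longleftrightarrow>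
     (\<forall>i<2 * n. {w ! i, w ! Suc i} \<in> edges G)"
    using assms by auto
  also have "\<dots> \<longleftrightarrow> (\<forall>i<n. {w ! i, w ! Suc i} \<in> edges G) \<and>
      (\<forall>i<n. {w ! (n + i), w ! Suc (n + i)} \<in> edges G)"
    by (simp add: all_less_double)
  finally have e: "(\<forall>i. Suc i < length w \<longrightarrow> {w ! i, w ! Suc i} \<in> edges G) \<longleftrightarrow>
      (\<forall>i<n. {w ! i, w ! Suc i} \<in> edges G) \<and>
      (\<forall>i<n. {w ! (n + i), w ! Suc (n + i)} \<in> edges G)" .
  have "set w = set (take (n + 1) w) \<union> set (drop n w)"
  proof -
    have "set w = set (take n w) \<union> set (drop n w)"
      by (metis append_take_drop_id set_append)
    moreover have "set (take n w) \<subseteq> set (take (n + 1) w)"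
      by (simp add: set_take_subset_set_take)
    moreover have "set (take (n + 1) w) \<subseteq> set w"
      by (rule set_take_subset)
    ultimately show ?thesis by blast
  qed
  then show ?thesis
    using assms unfolding walk_def e by auto
qed

lemma take_drop_ends:
  assumes "length w = 2 * n + 1"
  shows "take (n + 1) w ! 0 = w ! 0" "take (n + 1) w ! n = w ! n" "length (take (n + 1) w) = n + 1"
    "drop n w ! 0 = w ! n" "drop n w ! n = w ! (2 * n)" "length (drop n w) = n + 1"
  using assms by (simp_all add: mult_2)

text \<open>
  A dyadic block of level \<open>i < k\<close> never crosses the middle \<open>2 ^ k\<close>, so the conditions on blocks
  split into those of the two halves; the block of level \<open>k\<close> is the walk itself and contributes
  only that the ends differ, both halves already having distinct ends.
\<close>

lemma two_walk_split:
  assumes "0 < k" and "length w = 2 ^ Suc k + 1"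
  shows "two_walk G (Suc k) u v w \<longleftrightarrow> u \<noteq> v \<and>
     two_walk G k u (w ! (2 ^ k)) (take (2 ^ k + 1) w) \<and> two_walk G k (w ! (2 ^ k)) v (drop (2 ^ k) w)"
    (is "?L \<longleftrightarrow> ?R")
proof -
  let ?n = "2 ^ k :: nat"
  define D where "D i j \<longleftrightarrow> distinct [w ! (2 * j * 2 ^ i), w ! ((2 * j + 1) * 2 ^ i),
      w ! (2 * (j + 1) * 2 ^ i)]" for i j
  define E where "E j \<longleftrightarrow> {w ! (2 * j), w ! (2 * (j + 1))} \<notin> edges G" for j
  have len: "length w = 2 * ?n + 1" using assms by simp
  have le: "?n \<le> length w" using len by linarith
  have pw: "2 * 2 ^ (k - i - 1) * 2 ^ i = ?n" if "i < k" for i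
    using that by (simp flip: power_Suc power_add)
  have bound: "2 * (j + 1) * 2 ^ i \<le> ?n" if "i < k" "j < 2 ^ (k - i - 1)" for i j
  proof -
    have "2 * (j + 1) * 2 ^ i \<le> 2 * 2 ^ (k - i - 1) * 2 ^ i"
      using that by (intro mult_right_mono mult_left_mono) auto
    then show ?thesis using pw[OF that(1)] by simp
  qed
  have small: "2 * j * 2 ^ i < ?n + 1 \<and> (2 * j + 1) * 2 ^ i < ?n + 1 \<and> 2 * (j + 1) * 2 ^ i < ?n + 1"
    if "i < k" "j < 2 ^ (k - i - 1)" for i j
    using bound[OF that] by (auto simp: algebra_simps)
  have D1: "distinct [take (?n + 1) w ! (2 * j * 2 ^ i), take (?n + 1) w ! ((2 * j + 1) * 2 ^ i),
      take (?n + 1) w ! (2 * (j + 1) * 2 ^ i)] \<longleftrightarrow> D i j"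
    if "i < k" "j < 2 ^ (k - i - 1)" for i j
    using small[OF that] unfolding D_def by (simp only: nth_take)
  have D2: "distinct [drop ?n w ! (2 * j * 2 ^ i), drop ?n w ! ((2 * j + 1) * 2 ^ i),
      drop ?n w ! (2 * (j + 1) * 2 ^ i)] \<longleftrightarrow> D i (2 ^ (k - i - 1) + j)"
    if "i < k" for i j
  proof -
    have "2 * (2 ^ (k - i - 1) + j) * 2 ^ i = ?n + 2 * j * 2 ^ i"
      "(2 * (2 ^ (k - i - 1) + j) + 1) * 2 ^ i = ?n + (2 * j + 1) * 2 ^ i"
      "2 * (2 ^ (k - i - 1) + j + 1) * 2 ^ i = ?n + 2 * (j + 1) * 2 ^ i"
      using pw[OF that] by (simp_all add: algebra_simps)
    then show ?thesis
      unfolding D_def nth_drop[OF le] by (simp only:)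
  qed
  have dbl: "(2::nat) ^ (Suc k - i - 1) = 2 * 2 ^ (k - i - 1)" if "i < k" for i
    using less_imp_Suc_add[OF that] by auto
  have halfk: "(2::nat) ^ k = 2 * 2 ^ (k - 1)"
    using assms(1) by (cases k) simp_all
  have E1: "{take (?n + 1) w ! (2 * j), take (?n + 1) w ! (2 * (j + 1))} \<notin> edges G \<longleftrightarrow> E j"
    if "j < 2 ^ (k - 1)" for j
  proof -
    have "2 * j < ?n + 1" "2 * (j + 1) < ?n + 1" using that halfk by auto
    then show ?thesis unfolding E_def by (simp only: nth_take)
  qed
  have E2: "{drop ?n w ! (2 * j), drop ?n w ! (2 * (j + 1))} \<notin> edges G \<longleftrightarrow> E (2 ^ (k - 1) + j)"
    for j
  proof -
    have "2 * (2 ^ (k - 1) + j) = ?n + 2 * j" "2 * (2 ^ (k - 1) + j + 1) = ?n + 2 * (j + 1)"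
      using halfk by auto
    then show ?thesis unfolding E_def nth_drop[OF le] by (simp only:)
  qed
  have left: "two_walk G k u (w ! ?n) (take (?n + 1) w) \<longleftrightarrow>
     u \<noteq> w ! ?n \<and> walk G (take (?n + 1) w) \<and> w ! 0 = u \<and>
     (\<forall>i<k. \<forall>j<2 ^ (k - i - 1). D i j) \<and> (\<forall>j<2 ^ (k - 1). E j)"
  proof -
    have e1: "(\<forall>i<k. \<forall>j<2 ^ (k - i - 1). distinct [take (?n + 1) w ! (2 * j * 2 ^ i),
        take (?n + 1) w ! ((2 * j + 1) * 2 ^ i), take (?n + 1) w ! (2 * (j + 1) * 2 ^ i)]) \<longleftrightarrow>
      (\<forall>i<k. \<forall>j<2 ^ (k - i - 1). D i j)"
      by (rule all_cong, rule all_cong, rule D1)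
    have e2: "(\<forall>j<2 ^ (k - 1). {take (?n + 1) w ! (2 * j), take (?n + 1) w ! (2 * (j + 1))} \<notin> edges G)
        \<longleftrightarrow> (\<forall>j<2 ^ (k - 1). E j)"
      by (rule all_cong, rule E1)
    note e3 = take_drop_ends(1-3)[OF len]
    show ?thesis
      unfolding two_walk_def e1 e2 e3 eqTrueI[OF assms(1)] simp_thms
      by simp
  qed
  have right: "two_walk G k (w ! ?n) v (drop ?n w) \<longleftrightarrow>
     w ! ?n \<noteq> v \<and> walk G (drop ?n w) \<and> w ! (2 * ?n) = v \<and>
     (\<forall>i<k. \<forall>j<2 ^ (k - i - 1). D i (2 ^ (k - i - 1) + j)) \<and> (\<forall>j<2 ^ (k - 1). E (2 ^ (k - 1) + j))"
  proof -
    have e1: "(\<forall>i<k. \<forall>j<2 ^ (k - i - 1). distinct [drop ?n w ! (2 * j * 2 ^ i),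
        drop ?n w ! ((2 * j + 1) * 2 ^ i), drop ?n w ! (2 * (j + 1) * 2 ^ i)]) \<longleftrightarrow>
      (\<forall>i<k. \<forall>j<2 ^ (k - i - 1). D i (2 ^ (k - i - 1) + j))"
      by (rule all_cong, rule all_cong, rule D2)
    note e3 = take_drop_ends(4-6)[OF len]
    show ?thesis
      unfolding two_walk_def E2 e1 e3 eqTrueI[OF assms(1)] simp_thms
      by simp
  qed
  have Dall: "(\<forall>i<Suc k. \<forall>j<2 ^ (Suc k - i - 1). D i j) \<longleftrightarrow>
     (\<forall>i<k. (\<forall>j<2 ^ (k - i - 1). D i j) \<and> (\<forall>j<2 ^ (k - i - 1). D i (2 ^ (k - i - 1) + j))) \<and> D k 0"
  proof -
    have "(\<forall>i<Suc k. \<forall>j<2 ^ (Suc k - i - 1). D i j) \<longleftrightarrow>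
        (\<forall>i<k. \<forall>j<2 ^ (Suc k - i - 1). D i j) \<and> D k 0"
      by (simp add: All_less_Suc conj_commute)
    also have "(\<forall>i<k. \<forall>j<2 ^ (Suc k - i - 1). D i j) \<longleftrightarrow>
        (\<forall>i<k. \<forall>j<2 * 2 ^ (k - i - 1). D i j)"
    proof (intro all_cong)
      fix i assume "i < k"
      show "(\<forall>j<2 ^ (Suc k - i - 1). D i j) \<longleftrightarrow> (\<forall>j<2 * 2 ^ (k - i - 1). D i j)"
        unfolding dbl[OF \<open>i < k\<close>] ..
    qed
    finally show ?thesis unfolding all_less_double .
  qed
  have Eall: "(\<forall>j<2 ^ (Suc k - 1). E j) \<longleftrightarrow>
     (\<forall>j<2 ^ (k - 1). E j) \<and> (\<forall>j<2 ^ (k - 1). E (2 ^ (k - 1) + j))"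
    unfolding all_less_double[symmetric] halfk[symmetric] diff_Suc_1 ..
  have Dk: "D k 0 \<longleftrightarrow> distinct [w ! 0, w ! ?n, w ! (2 * ?n)]"
    by (simp add: D_def)
  have "?L \<longleftrightarrow> u \<noteq> v \<and> walk G w \<and> w ! 0 = u \<and> w ! (2 * ?n) = v \<and>
     (\<forall>i<Suc k. \<forall>j<2 ^ (Suc k - i - 1). D i j) \<and> (\<forall>j<2 ^ (Suc k - 1). E j)"
    unfolding two_walk_def D_def[symmetric] E_def[symmetric] power_Suc eqTrueI[OF len] simp_thms
    by (simp only: zero_less_Suc simp_thms)
  also have "\<dots> \<longleftrightarrow> ?R"
    unfolding left right Dall Eall Dk walk_split[OF len] by auto
  finally show ?thesis .
qed

text \<open>
  Minimality of the blocks of level below \<open>k\<close> is minimality of the two halves; what the longer walk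
  adds is the condition on the whole walk, that its ends are not the ends of a 2-walk of length \<open>k\<close>.
\<close>

lemma fully_minimal_split:
  assumes "0 < k" and "length w = 2 ^ Suc k + 1"
  shows "fully_minimal_two_walk G (Suc k) u v w \<longleftrightarrow> u \<noteq> v \<and> \<not> joined G k u v \<and>
     fully_minimal_two_walk G k u (w ! (2 ^ k)) (take (2 ^ k + 1) w) \<and>
     fully_minimal_two_walk G k (w ! (2 ^ k)) v (drop (2 ^ k) w)"
    (is "?L \<longleftrightarrow> ?R")
proof (cases "two_walk G (Suc k) u v w")
  case False
  then show ?thesis
    using two_walk_split[OF assms, of G u v] by (auto simp: fully_minimal_two_walk_def)
next
  case True
  let ?n = "2 ^ k :: nat"
  define J where "J i j \<longleftrightarrow> \<not> joined G i (w ! (j * 2 ^ (i + 1))) (w ! ((j + 1) * 2 ^ (i + 1)))" for i j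
  have len: "length w = 2 * ?n + 1" using assms by simp
  have uv: "w ! 0 = u" "w ! (2 * ?n) = v" "u \<noteq> v"
    using two_walk_ends[OF True] True by (auto simp: two_walk_split[OF assms])
  have pw: "2 ^ (k - i - 1) * 2 ^ (i + 1) = ?n" if "i < k" for i
    using that by (simp flip: power_Suc power_add)
  have J1: "\<not> joined G i (take (?n + 1) w ! (j * 2 ^ (i + 1))) (take (?n + 1) w ! ((j + 1) * 2 ^ (i + 1)))
      \<longleftrightarrow> J i j" if "i < k" "j < 2 ^ (k - i - 1)" for i j
  proof -
    have "(j + 1) * 2 ^ (i + 1) \<le> 2 ^ (k - i - 1) * 2 ^ (i + 1)"
      using that by (intro mult_right_mono) auto
    then have "(j + 1) * 2 ^ (i + 1) < ?n + 1" using pw[OF that(1)] by simp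
    moreover then have "j * 2 ^ (i + 1) < ?n + 1" by (simp add: algebra_simps)
    ultimately show ?thesis unfolding J_def by (simp only: nth_take)
  qed
  have J2: "\<not> joined G i (drop ?n w ! (j * 2 ^ (i + 1))) (drop ?n w ! ((j + 1) * 2 ^ (i + 1)))
      \<longleftrightarrow> J i (2 ^ (k - i - 1) + j)" if "i < k" for i j
  proof -
    have "(2 ^ (k - i - 1) + j) * 2 ^ (i + 1) = ?n + j * 2 ^ (i + 1)"
      "(2 ^ (k - i - 1) + j + 1) * 2 ^ (i + 1) = ?n + (j + 1) * 2 ^ (i + 1)"
      using pw[OF that] by (simp_all add: algebra_simps)
    then show ?thesis unfolding J_def using len by (simp only: nth_drop)
  qed
  have dbl: "(2::nat) ^ (Suc k - i - 1) = 2 * 2 ^ (k - i - 1)" if "i < k" for i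
    using less_imp_Suc_add[OF that] by auto
  have halves: "two_walk G k u (w ! ?n) (take (?n + 1) w)" "two_walk G k (w ! ?n) v (drop ?n w)"
    using True unfolding two_walk_split[OF assms] by blast+
  have left: "fully_minimal_two_walk G k u (w ! ?n) (take (?n + 1) w) \<longleftrightarrow>
     (\<forall>i\<in>{1..k - 1}. \<forall>j<2 ^ (k - i - 1). J i j)"
    unfolding fully_minimal_two_walk_def joined_def[symmetric] simp_thms eqTrueI[OF halves(1)]
    using assms(1) by (intro ball_cong refl all_cong J1) auto
  have right: "fully_minimal_two_walk G k (w ! ?n) v (drop ?n w) \<longleftrightarrow>
     (\<forall>i\<in>{1..k - 1}. \<forall>j<2 ^ (k - i - 1). J i (2 ^ (k - i - 1) + j))"
    unfolding fully_minimal_two_walk_def joined_def[symmetric] simp_thms eqTrueI[OF halves(2)]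
    using assms(1) by (intro ball_cong refl all_cong J2) auto
  have "?L \<longleftrightarrow> (\<forall>i\<in>{1..k}. \<forall>j<2 ^ (Suc k - i - 1). J i j)"
    using True unfolding fully_minimal_two_walk_def joined_def[symmetric] J_def by simp
  also have "{1..k} = insert k {1..k - 1}"
    using assms(1) by auto
  also have "(\<forall>i\<in>insert k {1..k - 1}. \<forall>j<2 ^ (Suc k - i - 1). J i j) \<longleftrightarrow>
      J k 0 \<and> (\<forall>i\<in>{1..k - 1}. \<forall>j<2 * 2 ^ (k - i - 1). J i j)"
  proof -
    have "(\<forall>i\<in>{1..k - 1}. \<forall>j<2 ^ (Suc k - i - 1). J i j) \<longleftrightarrow>
        (\<forall>i\<in>{1..k - 1}. \<forall>j<2 * 2 ^ (k - i - 1). J i j)"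
    proof (intro ball_cong refl)
      fix i assume "i \<in> {1..k - 1}"
      then have "i < k" using assms(1) by auto
      show "(\<forall>j<2 ^ (Suc k - i - 1). J i j) \<longleftrightarrow> (\<forall>j<2 * 2 ^ (k - i - 1). J i j)"
        unfolding dbl[OF \<open>i < k\<close>] ..
    qed
    then show ?thesis by simp
  qed
  also have "J k 0 \<longleftrightarrow> \<not> joined G k u v"
    using uv by (simp add: J_def)
  finally show ?thesis
    unfolding left right all_less_double using uv by blast
qed

lemma concat_halves:
  assumes "length p = n + 1" "length q = n + 1" "p ! n = q ! 0"
  defines "w \<equiv> p @ tl q"
  shows "length w = 2 * n + 1" "take (n + 1) w = p" "drop n w = q" "w ! n = p ! n"
proof -
  show "length w = 2 * n + 1" "take (n + 1) w = p" "w ! n = p ! n"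
    using assms by (auto simp: nth_append)
  have "drop n p = [p ! n]"
    using assms(1) by (simp add: Cons_nth_drop_Suc[symmetric])
  moreover have "q = q ! 0 # tl q"
    using assms(2) by (cases q) auto
  ultimately show "drop n w = q"
    using assms by (metis append_Cons append_Nil cancel_comm_monoid_add_class.diff_cancel
        diff_is_0_eq drop_0 drop_append le_add1)
qed

lemma joined_Suc:
  assumes "0 < k"
  shows "joined G (Suc k) u v \<longleftrightarrow> u \<noteq> v \<and> (\<exists>x. joined G k u x \<and> joined G k x v)"
proof
  assume "joined G (Suc k) u v"
  then obtain w where w: "two_walk G (Suc k) u v w" by (auto simp: joined_def)
  from two_walk_split[OF assms two_walk_ends(1)[OF w], of G u v] w
  show "u \<noteq> v \<and> (\<exists>x. joined G k u x \<and> joined G k x v)"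
    unfolding joined_def by blast
next
  assume "u \<noteq> v \<and> (\<exists>x. joined G k u x \<and> joined G k x v)"
  then obtain x p q where pq: "u \<noteq> v" "two_walk G k u x p" "two_walk G k x v q"
    by (auto simp: joined_def)
  note p = two_walk_ends[OF pq(2)] and q = two_walk_ends[OF pq(3)]
  have "length p = 2 ^ k + 1" "length q = 2 ^ k + 1" "p ! (2 ^ k) = q ! 0" "p ! (2 ^ k) = x"
    using p q by simp_all
  note w = concat_halves[OF this(1-3)] this(4)
  have "two_walk G (Suc k) u v (p @ tl q)"
    using two_walk_split[OF assms, of "p @ tl q" G u v] w pq by simp
  then show "joined G (Suc k) u v" by (auto simp: joined_def)
qed

lemma min_joined_Suc:
  assumes "0 < k"
  shows "min_joined G (Suc k) u v \<longleftrightarrow>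
    u \<noteq> v \<and> \<not> joined G k u v \<and> (\<exists>x. min_joined G k u x \<and> min_joined G k x v)"
proof
  assume "min_joined G (Suc k) u v"
  then obtain w where w: "fully_minimal_two_walk G (Suc k) u v w" by (auto simp: min_joined_def)
  from fully_minimal_split[OF assms two_walk_ends(1)[OF fully_minimal_imp_two_walk[OF w]], of G u v] w
  show "u \<noteq> v \<and> \<not> joined G k u v \<and> (\<exists>x. min_joined G k u x \<and> min_joined G k x v)"
    unfolding min_joined_def by blast
next
  assume "u \<noteq> v \<and> \<not> joined G k u v \<and> (\<exists>x. min_joined G k u x \<and> min_joined G k x v)"
  then obtain x p q where pq: "u \<noteq> v" "\<not> joined G k u v"
      "fully_minimal_two_walk G k u x p" "fully_minimal_two_walk G k x v q"
    by (auto simp: min_joined_def)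
  note p = two_walk_ends[OF fully_minimal_imp_two_walk[OF pq(3)]]
    and q = two_walk_ends[OF fully_minimal_imp_two_walk[OF pq(4)]]
  have "length p = 2 ^ k + 1" "length q = 2 ^ k + 1" "p ! (2 ^ k) = q ! 0" "p ! (2 ^ k) = x"
    using p q by simp_all
  note w = concat_halves[OF this(1-3)] this(4)
  have "fully_minimal_two_walk G (Suc k) u v (p @ tl q)"
    using fully_minimal_split[OF assms, of "p @ tl q" G u v] w pq by simp
  then show "min_joined G (Suc k) u v" by (auto simp: min_joined_def)
qed

text \<open>
  The middle vertex is required to differ from both ends, because a 2-walk asks for it and \<open>G\<close> may
  have singleton edges.
\<close>

lemma joined_one:
  "joined G 1 u v \<longleftrightarrow> u \<in> verts G \<and> v \<in> verts G \<and> u \<noteq> v \<and> {u, v} \<notin> edges G \<and>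
     (\<exists>x \<in> verts G. x \<noteq> u \<and> x \<noteq> v \<and> {u, x} \<in> edges G \<and> {x, v} \<in> edges G)"
    (is "?L \<longleftrightarrow> ?R")
proof
  assume ?L
  then obtain w where w: "two_walk G 1 u v w" by (auto simp: joined_def)
  then have "length w = 3" by (simp add: two_walk_def)
  then obtain a b c where "w = [a, b, c]"
    by (auto simp: numeral_3_eq_3 length_Suc_conv)
  with w show ?R
    by (auto simp: two_walk_def walk_def less_Suc_eq)
next
  assume ?R
  then obtain x where "x \<in> verts G" "x \<noteq> u" "x \<noteq> v" "{u, x} \<in> edges G" "{x, v} \<in> edges G"
    by auto
  with \<open>?R\<close> have "two_walk G 1 u v [u, x, v]"
    by (auto simp: two_walk_def walk_def less_Suc_eq)
  then show ?L by (auto simp: joined_def)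
qed

lemma joined_oneE:
  assumes "joined G 1 u v"
  obtains x where "{u, x} \<in> edges G" "{x, v} \<in> edges G" "u \<noteq> v"
  using assms unfolding joined_one by auto

lemma min_joined_one: "min_joined G 1 = joined G 1"
  by (intro ext) (auto simp: min_joined_def joined_def fully_minimal_two_walk_def)

lemma joined_pos: "joined G k u v \<Longrightarrow> 0 < k"
  by (auto simp: joined_def two_walk_def)

lemma min_joined_imp_joined: "min_joined G k u v \<Longrightarrow> joined G k u v"
  by (auto simp: min_joined_def joined_def fully_minimal_two_walk_def)

lemma joined_sym: "joined G k u v \<Longrightarrow> joined G k v u"
proof (induction k arbitrary: u v)
  case (Suc k)
  show ?case
  proof (cases "k = 0")
    case True
    with Suc.prems show ?thesis by (auto simp: joined_one[unfolded One_nat_def] insert_commute)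
  next
    case False
    with Suc show ?thesis by (auto simp: joined_Suc)
  qed
qed (auto dest: joined_pos)

lemma min_joined_sym: "min_joined G k u v \<Longrightarrow> min_joined G k v u"
proof (induction k arbitrary: u v)
  case (Suc k)
  show ?case
  proof (cases "k = 0")
    case True
    with Suc.prems show ?thesis
      by (auto simp: min_joined_one[unfolded One_nat_def] intro: joined_sym)
  next
    case False
    with Suc show ?thesis by (auto simp: min_joined_Suc dest: joined_sym)
  qed
qed (auto dest: joined_pos min_joined_imp_joined)

lemma joined_verts: "joined G k u v \<Longrightarrow> u \<in> verts G \<and> v \<in> verts G \<and> u \<noteq> v"
  unfolding joined_def two_walk_def walk_def by (auto intro: nth_mem)

lemmas min_joined_verts = joined_verts[OF min_joined_imp_joined]
  and min_joined_pos = joined_pos[OF min_joined_imp_joined]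

lemma mem_FM_iff: "{u, v} \<in> FM G k \<longleftrightarrow> min_joined G k u v"
proof
  assume "{u, v} \<in> FM G k"
  then obtain a b where "{u, v} = {a, b}" "min_joined G k a b"
    unfolding FM_def min_joined_def by blast
  then show "min_joined G k u v"
    using min_joined_sym[of G k a b] by (auto simp: doubleton_eq_iff)
next
  assume "min_joined G k u v"
  moreover from min_joined_verts[OF this]
  have "u \<in> verts G" "v \<in> verts G" "u \<noteq> v" by auto
  ultimately show "{u, v} \<in> FM G k"
    unfolding FM_def min_joined_def by blast
qed

section \<open>Adjacency in iterated metamour graphs\<close>

lemma verts_metamour_pow [simp]: "verts ((metamour ^^ n) G) = verts G"
  by (induction n) (auto simp: metamour_def)

lemma gdist_eq_2_iff:
  assumes "u \<in> verts G" "v \<in> verts G"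
  shows "gdist G u v = 2 \<longleftrightarrow> u \<noteq> v \<and> {u, v} \<notin> edges G \<and>
    (\<exists>x \<in> verts G. {u, x} \<in> edges G \<and> {x, v} \<in> edges G)"
proof -
  define S where "S = {n. \<exists>w. walk G w \<and> length w = n + 1 \<and> hd w = u \<and> last w = v}"
  have g: "gdist G u v = Inf (enat ` S)"
    unfolding gdist_def S_def by (rule arg_cong[where f = Inf]) auto
  have S0: "0 \<in> S \<longleftrightarrow> u = v"
    using assms by (auto simp: S_def walk_def length_Suc_conv intro!: exI[of _ "[v]"])
  have S1: "1 \<in> S \<longleftrightarrow> {u, v} \<in> edges G"
    using assms by (auto simp: S_def walk_def length_Suc_conv intro!: exI[of _ "[u, v]"])
  have S2: "2 \<in> S \<longleftrightarrow> (\<exists>x \<in> verts G. {u, x} \<in> edges G \<and> {x, v} \<in> edges G)"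
  proof
    assume "2 \<in> S"
    then obtain w where "walk G w" "length w = 3" "hd w = u" "last w = v" by (auto simp: S_def)
    moreover from \<open>length w = 3\<close> obtain a b c where "w = [a, b, c]"
      by (auto simp: numeral_3_eq_3 length_Suc_conv)
    ultimately show "\<exists>x \<in> verts G. {u, x} \<in> edges G \<and> {x, v} \<in> edges G"
      by (auto simp: walk_def less_Suc_eq)
  next
    assume "\<exists>x \<in> verts G. {u, x} \<in> edges G \<and> {x, v} \<in> edges G"
    then obtain x where "x \<in> verts G" "{u, x} \<in> edges G" "{x, v} \<in> edges G" by auto
    then have "walk G [u, x, v]" using assms by (auto simp: walk_def less_Suc_eq)
    then show "2 \<in> S" unfolding S_def by (auto intro!: exI[of _ "[u, x, v]"])
  qed
  have "Inf (enat ` S) = 2 \<longleftrightarrow> 0 \<notin> S \<and> 1 \<notin> S \<and> 2 \<in> S"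
  proof (cases "S = {}")
    case True
    then show ?thesis by (auto simp: Inf_enat_def)
  next
    case False
    then have "Inf (enat ` S) = enat (Inf S)"
      unfolding Inf_enat_def by (auto intro!: Least_equality simp: Inf_nat_def
        intro: LeastI Least_le)
    then have i: "Inf (enat ` S) = 2 \<longleftrightarrow> Inf S = 2"
      by (metis enat.inject numeral_eq_enat)
    have mem: "Inf S \<in> S" using False by (rule Inf_nat_def1)
    have le: "Inf S \<le> n" if "n \<in> S" for n using that by (rule wellorder_Inf_le1)
    show ?thesis
      unfolding i
    proof
      assume S: "Inf S = 2"
      have "n \<notin> S" if "n < 2" for n
        using le[of n] that S by linarith
      then show "0 \<notin> S \<and> 1 \<notin> S \<and> 2 \<in> S"
        using mem S by simp
    next
      assume S: "0 \<notin> S \<and> 1 \<notin> S \<and> 2 \<in> S"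
      then have "Inf S \<noteq> 0" "Inf S \<noteq> 1" using mem by metis+
      moreover have "Inf S \<le> 2" using S le by blast
      ultimately show "Inf S = 2" by linarith
    qed
  qed
  then show ?thesis unfolding g S0 S1 S2 by auto
qed

lemma edge_metamour_iff:
  "{u, v} \<in> edges (metamour G) \<longleftrightarrow> u \<in> verts G \<and> v \<in> verts G \<and> u \<noteq> v \<and> {u, v} \<notin> edges G \<and>
     (\<exists>x \<in> verts G. {u, x} \<in> edges G \<and> {x, v} \<in> edges G)" (is "?L \<longleftrightarrow> ?R")
proof
  assume ?L
  then obtain a b where "{u, v} = {a, b}" "a \<in> verts G" "b \<in> verts G" "gdist G a b = 2"
    by (auto simp: metamour_def)
  moreover from this have "a \<noteq> b" "{a, b} \<notin> edges G"
    "\<exists>x \<in> verts G. {a, x} \<in> edges G \<and> {x, b} \<in> edges G"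
    by (auto simp: gdist_eq_2_iff)
  ultimately show ?R by (auto simp: doubleton_eq_iff insert_commute)
next
  assume ?R
  then have "u \<in> verts G" "v \<in> verts G" "gdist G u v = 2"
    by (auto simp: gdist_eq_2_iff)
  then show ?L unfolding metamour_def snd_conv by blast
qed

lemma edges_metamour_cases:
  assumes "e \<in> edges (metamour G)"
  obtains x y where "e = {x, y}" "x \<in> verts G" "y \<in> verts G"
  using assms by (auto simp: metamour_def)

abbreviation metamour_adj :: "'a ugraph \<Rightarrow> nat \<Rightarrow> 'a \<Rightarrow> 'a \<Rightarrow> bool" where
  "metamour_adj G n u v \<equiv> {u, v} \<in> edges ((metamour ^^ n) G)"

lemma metamour_adj_Suc:
  "metamour_adj G (Suc n) u v \<longleftrightarrow> u \<in> verts G \<and> v \<in> verts G \<and> u \<noteq> v \<and> \<not> metamour_adj G n u v \<and>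
     (\<exists>x \<in> verts G. metamour_adj G n u x \<and> metamour_adj G n x v)"
  by (simp add: edge_metamour_iff)

section \<open>Persistence of fully minimal pairs\<close>

text \<open>
  The hypothesis is that every edge of \<open>G\<close> joins two vertices with a common metamour. It holds when
  every edge lies in an induced pentagon, the common metamour being the opposite vertex, and it is
  what makes the edges of \<open>G\<close> come back in the second iterate.
\<close>

locale metamour_midpoint_graph =
  fixes G :: "'a ugraph"
  assumes edge_midpoint: "\<lbrakk>{u, v} \<in> edges G; u \<in> verts G; v \<in> verts G\<rbrakk> \<Longrightarrow>
    u \<noteq> v \<and> (\<exists>x. joined G 1 u x \<and> joined G 1 x v)"
begin

lemma metamour_adj_one: "metamour_adj G 1 u v \<longleftrightarrow> joined G 1 u v"
proof -
  have "metamour_adj G 1 u v \<longleftrightarrow> u \<in> verts G \<and> v \<in> verts G \<and> u \<noteq> v \<and> {u, v} \<notin> edges G \<and>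
     (\<exists>x \<in> verts G. {u, x} \<in> edges G \<and> {x, v} \<in> edges G)"
    using metamour_adj_Suc[of u v 0 G] by simp
  then show ?thesis
    unfolding joined_one using edge_midpoint by metis
qed

text \<open>
  The converse fails in general: a 2-walk between \<open>u\<close> and \<open>v\<close> does not exclude that \<open>u\<close> and \<open>v\<close>
  are adjacent in the preceding iterate.
\<close>

lemma metamour_adj_imp_joined: "metamour_adj G (Suc n) u v \<Longrightarrow> joined G (Suc n) u v"
proof (induction n arbitrary: u v)
  case 0
  then show ?case by (metis metamour_adj_one One_nat_def)
next
  case (Suc n)
  then have "u \<noteq> v \<and> (\<exists>x. metamour_adj G (Suc n) u x \<and> metamour_adj G (Suc n) x v)"
    using metamour_adj_Suc[of u v "Suc n" G] by blast
  then show ?case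
    using Suc.IH joined_Suc[of "Suc n" G u v] by blast
qed

text \<open>
  The engine of the periodicity: a pair adjacent in the iterate \<open>n + 2 * i\<close> is not adjacent in the
  next one, so a common neighbour in the next one makes it adjacent in the iterate after that.
\<close>

lemma metamour_adj_persists:
  assumes start: "metamour_adj G n u v" and V: "u \<in> verts G" "v \<in> verts G" "u \<noteq> v" "x \<in> verts G"
    and mid: "\<And>i. metamour_adj G (n + 2 * i + 1) u x" "\<And>i. metamour_adj G (n + 2 * i + 1) x v"
  shows "metamour_adj G (n + 2 * i) u v"
proof (induction i)
  case 0
  then show ?case using start by simp
next
  case (Suc i)
  have "\<not> metamour_adj G (Suc (n + 2 * i)) u v"
    using Suc.IH metamour_adj_Suc[of u v "n + 2 * i" G] by blast
  then have "metamour_adj G (Suc (Suc (n + 2 * i))) u v"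
    using mid[of i] V unfolding metamour_adj_Suc[of u v "Suc (n + 2 * i)" G] by auto
  then show ?case by (simp only: mult_Suc_right add_Suc_right add_2_eq_Suc)
qed

text \<open>
  Base of the induction on the length. Edges and pairs at distance two support each other: a common
  neighbour for an edge is given by two pairs at distance two, and conversely. Therefore both
  statements are proved together.
\<close>

lemma edge_and_distance_two_persist:
  "(\<forall>u v. {u, v} \<in> edges G \<longrightarrow> u \<in> verts G \<longrightarrow> v \<in> verts G \<longrightarrow> metamour_adj G (2 * i) u v) \<and>
   (\<forall>u v. joined G 1 u v \<longrightarrow> metamour_adj G (Suc (2 * i)) u v)"
proof (induction i)
  case 0
  have "metamour_adj G (Suc 0) u v" if "joined G 1 u v" for u v
    using that metamour_adj_one unfolding One_nat_def by blast
  then show ?case by simp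
next
  case (Suc i)
  have edge: "metamour_adj G (Suc (Suc (2 * i))) u v"
    if e: "{u, v} \<in> edges G" "u \<in> verts G" "v \<in> verts G" for u v
  proof -
    obtain x where x: "u \<noteq> v" "joined G 1 u x" "joined G 1 x v"
      using edge_midpoint[OF e] by blast
    have "metamour_adj G (2 * i) u v"
      using Suc e by blast
    then have "\<not> metamour_adj G (Suc (2 * i)) u v"
      unfolding metamour_adj_Suc[of u v "2 * i" G] by blast
    moreover have "metamour_adj G (Suc (2 * i)) u x" "metamour_adj G (Suc (2 * i)) x v"
      using Suc x by blast+
    moreover have "x \<in> verts G"
      using joined_verts[OF x(2)] by blast
    ultimately show ?thesis
      unfolding metamour_adj_Suc[of u v "Suc (2 * i)" G] using e x(1) by blast
  qed
  have two: "metamour_adj G (Suc (Suc (Suc (2 * i)))) u v" if j: "joined G 1 u v" for u v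
  proof -
    obtain x where x: "x \<in> verts G" "{u, x} \<in> edges G" "{x, v} \<in> edges G"
      using j unfolding joined_one by blast
    have V: "u \<in> verts G" "v \<in> verts G" "u \<noteq> v" using joined_verts[OF j] by auto
    have "metamour_adj G (Suc (2 * i)) u v" using Suc j by blast
    then have "\<not> metamour_adj G (Suc (Suc (2 * i))) u v"
      unfolding metamour_adj_Suc[of u v "Suc (2 * i)" G] by blast
    then show ?thesis
      unfolding metamour_adj_Suc[of u v "Suc (Suc (2 * i))" G] using V x edge by blast
  qed
  show ?case using edge two by simp
qed

text \<open>
  For a pair with a fully minimal 2-walk of length \<open>k + 1\<close>, the middle of the walk is by induction a
  common neighbour in all iterates \<open>k, k + 2, \<dots>\<close>. Minimality is used at the start: without a
  2-walk of length \<open>k\<close> the pair is not adjacent in the iterate \<open>k\<close>, hence it is adjacent in the next.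
\<close>

lemma min_joined_persists: "min_joined G (Suc k) u v \<Longrightarrow> metamour_adj G (Suc k + 2 * i) u v"
proof (induction k arbitrary: u v i)
  case 0
  then show ?case
    using edge_and_distance_two_persist[of i] by (simp add: min_joined_one[unfolded One_nat_def])
next
  case (Suc k)
  obtain x where x: "u \<noteq> v" "\<not> joined G (Suc k) u v" "min_joined G (Suc k) u x" "min_joined G (Suc k) x v"
    using min_joined_Suc[OF zero_less_Suc, THEN iffD1, OF Suc.prems] by blast
  have V: "u \<in> verts G" "v \<in> verts G" "x \<in> verts G"
    using min_joined_verts[OF x(3)]
      min_joined_verts[OF x(4)] by auto
  have mid: "metamour_adj G (Suc k + 2 * j) u x" "metamour_adj G (Suc k + 2 * j) x v" for j
    by (rule Suc.IH[OF x(3)], rule Suc.IH[OF x(4)])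
  have "\<not> metamour_adj G (Suc k) u v"
    using x(2) metamour_adj_imp_joined by blast
  then have "metamour_adj G (Suc (Suc k)) u v"
    using mid[of 0, unfolded mult_0_right add_0_right] V x(1)
    unfolding metamour_adj_Suc[of u v "Suc k" G] by blast
  moreover have "Suc k + 2 * Suc j = Suc (Suc k) + 2 * j + 1" for j by simp
  then have "metamour_adj G (Suc (Suc k) + 2 * j + 1) u x" "metamour_adj G (Suc (Suc k) + 2 * j + 1) x v" for j
    using mid[of "Suc j"] by metis+
  ultimately show ?case
    using metamour_adj_persists V x(1) by blast
qed

lemma min_joined_imp_metamour_adj:
  assumes "min_joined G k u v" "k \<le> n" "even n \<longleftrightarrow> even k"
  shows "metamour_adj G n u v"
proof -
  obtain k' where k': "k = Suc k'" using min_joined_pos[OF assms(1)] gr0_implies_Suc by blast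
  have "even (n - k)" using assms(2,3) by simp
  then obtain i where "n - k = 2 * i" by (rule evenE)
  then have "n = Suc k' + 2 * i" using assms(2) k' by linarith
  then show ?thesis using min_joined_persists[of k' u v i] assms(1) k' by (simp only:)
qed

text \<open>
  Otherwise the pair would be adjacent in two consecutive iterates.
\<close>

lemma min_joined_parity:
  assumes "min_joined G k u v" "min_joined G l u v"
  shows "even k \<longleftrightarrow> even l"
proof (rule ccontr)
  assume "\<not> ?thesis"
  then have "metamour_adj G (k + 2 * l) u v" "metamour_adj G (Suc (k + 2 * l)) u v"
    using min_joined_imp_metamour_adj[OF assms(1), of "k + 2 * l"]
      min_joined_imp_metamour_adj[OF assms(2), of "Suc (k + 2 * l)"] by (auto simp del: funpow.simps)
  then show False using metamour_adj_Suc[of u v "k + 2 * l" G] by blast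
qed

end

section \<open>Graphs covered by fully minimal pairs\<close>

lemma FM_pair: "e \<in> FM G k \<Longrightarrow> \<exists>u v. e = {u, v}"
  unfolding FM_def by blast

lemma pair_set_eqI:
  assumes "\<And>e. e \<in> A \<Longrightarrow> \<exists>u v. e = {u, v}" "\<And>e. e \<in> B \<Longrightarrow> \<exists>u v. e = {u, v}"
    and "\<And>u v. {u, v} \<in> A \<longleftrightarrow> {u, v} \<in> B"
  shows "A = B"
  using assms by (metis subsetI subset_antisym)

text \<open>
  If fully minimal 2-walks of length at most \<open>N\<close> reach all pairs, then each pair has a well-defined
  parity, and from the iterate \<open>N\<close> on it is adjacent exactly in the iterates of that parity.
\<close>

locale minimally_covered_graph = metamour_midpoint_graph G for G :: "'a ugraph" +
  fixes N :: nat
  assumes ex_distinct: "\<exists>u \<in> verts G. \<exists>v \<in> verts G. u \<noteq> v"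
    and cover: "\<lbrakk>u \<in> verts G; v \<in> verts G; u \<noteq> v\<rbrakk> \<Longrightarrow> \<exists>k. k \<le> N \<and> min_joined G k u v"
begin

lemma N_pos: "0 < N"
proof -
  obtain a b where "a \<in> verts G" "b \<in> verts G" "a \<noteq> b" using ex_distinct by blast
  then obtain k where "k \<le> N" "min_joined G k a b" using cover by blast
  then show ?thesis using min_joined_pos by fastforce
qed

text \<open>
  A pair of the other parity is adjacent in the iterate \<open>n + 1\<close>, hence not in the iterate \<open>n\<close>.
\<close>

lemma metamour_adj_iff:
  assumes "N \<le> n"
  shows "metamour_adj G n u v \<longleftrightarrow> (\<exists>k. min_joined G k u v \<and> (even k \<longleftrightarrow> even n))"
proof
  assume A: "metamour_adj G n u v"
  obtain n' where "n = Suc n'" using assms N_pos by (cases n) auto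
  with A have V: "u \<in> verts G" "v \<in> verts G" "u \<noteq> v"
    using metamour_adj_Suc[of u v n' G] by auto
  then obtain k where k: "k \<le> N" "min_joined G k u v" using cover by blast
  have "even k \<longleftrightarrow> even n"
  proof (rule ccontr)
    assume "\<not> ?thesis"
    then have "metamour_adj G (Suc n) u v"
      using assms k(1) min_joined_imp_metamour_adj[OF k(2), of "Suc n"] by (auto simp del: funpow.simps)
    then show False using A metamour_adj_Suc[of u v n G] by blast
  qed
  with k show "\<exists>k. min_joined G k u v \<and> (even k \<longleftrightarrow> even n)" by blast
next
  assume "\<exists>k. min_joined G k u v \<and> (even k \<longleftrightarrow> even n)"
  then obtain k where k: "min_joined G k u v" "even k \<longleftrightarrow> even n" by blast
  obtain l where l: "l \<le> N" "min_joined G l u v"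
    using cover min_joined_verts[OF k(1)] by blast
  show "metamour_adj G n u v"
    using min_joined_imp_metamour_adj[OF l(2)] l(1) k assms min_joined_parity[OF l(2) k(1)] by auto
qed

lemma mem_FM_ev_iff: "{u, v} \<in> FM_ev G \<longleftrightarrow> (\<exists>k. min_joined G k u v \<and> even k)"
  using min_joined_pos[of G _ u v] unfolding FM_ev_def by (auto simp: mem_FM_iff)

lemma mem_FM_od_iff: "{u, v} \<in> FM_od G \<longleftrightarrow> (\<exists>k. min_joined G k u v \<and> odd k)"
  using min_joined_pos[of G _ u v] unfolding FM_od_def by (auto simp: mem_FM_iff)

lemma FM_ev_pair: "e \<in> FM_ev G \<Longrightarrow> \<exists>u v. e = {u, v}"
  unfolding FM_ev_def using FM_pair by blast

lemma FM_od_pair: "e \<in> FM_od G \<Longrightarrow> \<exists>u v. e = {u, v}"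
  unfolding FM_od_def using FM_pair by blast

lemma metamour_pow_pair:
  assumes "N \<le> n" and "e \<in> edges ((metamour ^^ n) G)"
  shows "\<exists>u v. e = {u, v}"
proof -
  obtain n' where "n = Suc n'" using assms N_pos by (cases n) auto
  then show ?thesis using assms(2) by (auto elim!: edges_metamour_cases)
qed

lemma edges_metamour_pow:
  assumes "N \<le> n"
  shows "edges ((metamour ^^ n) G) = (if even n then FM_ev G else FM_od G)"
proof (rule pair_set_eqI)
  show "\<exists>u v. e = {u, v}" if "e \<in> edges ((metamour ^^ n) G)" for e
    by (rule metamour_pow_pair[OF assms that])
  show "\<exists>u v. e = {u, v}" if "e \<in> (if even n then FM_ev G else FM_od G)" for e
    using that FM_ev_pair FM_od_pair by (cases "even n") auto
  show "metamour_adj G n u v \<longleftrightarrow> {u, v} \<in> (if even n then FM_ev G else FM_od G)" for u v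
    unfolding metamour_adj_iff[OF assms] by (simp add: mem_FM_ev_iff mem_FM_od_iff)
qed

lemma metamour_pow_eq:
  assumes "N \<le> n"
  shows "(metamour ^^ n) G = (verts G, if even n then FM_ev G else FM_od G)"
  by (rule prod_eqI) (simp_all only: fst_conv snd_conv verts_metamour_pow edges_metamour_pow[OF assms])

lemma FM_ev_neq_FM_od: "FM_ev G \<noteq> FM_od G"
proof -
  obtain a b where "a \<in> verts G" "b \<in> verts G" "a \<noteq> b" using ex_distinct by blast
  then obtain k where "min_joined G k a b" using cover by blast
  then have "{a, b} \<in> FM_ev G \<longleftrightarrow> {a, b} \<notin> FM_od G"
    unfolding mem_FM_ev_iff mem_FM_od_iff using min_joined_parity by blast
  then show ?thesis by auto
qed

lemma periodic_two: "metamour_periodic_from G 2 N"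
  unfolding metamour_periodic_from_def
proof (intro allI impI)
  fix i assume i: "N \<le> i"
  then have i2: "N \<le> 2 + i" by simp
  show "(metamour ^^ (2 + i)) G = (metamour ^^ i) G"
    unfolding metamour_pow_eq[OF i] metamour_pow_eq[OF i2] by simp
qed

theorem limit_period: "has_metamour_limit_period G 2"
  unfolding has_metamour_limit_period_def
proof (intro conjI allI impI)
  fix k assume k: "0 < k \<and> (\<exists>M. metamour_periodic_from G k M)"
  show "2 \<le> k"
  proof (rule ccontr)
    assume "\<not> 2 \<le> k"
    then have "k = 1" using k by simp
    with k obtain M where "metamour_periodic_from G 1 M" by blast
    moreover have le: "M \<le> M + N" "N \<le> M + N" "N \<le> 1 + (M + N)" by simp_all
    ultimately have "(metamour ^^ (1 + (M + N))) G = (metamour ^^ (M + N)) G"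
      unfolding metamour_periodic_from_def by blast
    then have "(if even (1 + (M + N)) then FM_ev G else FM_od G) =
       (if even (M + N) then FM_ev G else FM_od G)"
      unfolding metamour_pow_eq[OF le(2)] metamour_pow_eq[OF le(3)] by (rule Pair_inject)
    then show False using FM_ev_neq_FM_od by (auto split: if_splits)
  qed
qed (use periodic_two in auto)

theorem limit_set: "is_metamour_limit_set G {(verts G, FM_ev G), (verts G, FM_od G)}"
proof -
  have "{(verts G, FM_ev G), (verts G, FM_od G)} = {(metamour ^^ i) G | i. N \<le> i}"
  proof (intro equalityI subsetI)
    fix H assume "H \<in> {(verts G, FM_ev G), (verts G, FM_od G)}"
    then have "H = (metamour ^^ (2 * N)) G \<or> H = (metamour ^^ (2 * N + 1)) G"
      using metamour_pow_eq[of "2 * N"] metamour_pow_eq[of "2 * N + 1"] by simp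
    moreover have "N \<le> 2 * N" "N \<le> 2 * N + 1" by auto
    ultimately show "H \<in> {(metamour ^^ i) G | i. N \<le> i}" by blast
  next
    fix H assume "H \<in> {(metamour ^^ i) G | i. N \<le> i}"
    then obtain i where "N \<le> i" "H = (metamour ^^ i) G" by blast
    then show "H \<in> {(verts G, FM_ev G), (verts G, FM_od G)}"
      using metamour_pow_eq[of i] by simp
  qed
  then show ?thesis
    unfolding is_metamour_limit_set_def using limit_period periodic_two by blast
qed

text \<open>
  A pair with a fully minimal 2-walk of any length also has one of length at most \<open>N\<close>, and its length
  has the same parity.
\<close>

lemma FM_parity_stabilizes:
  "(\<Union>k\<in>{k. 0 < k \<and> (even k \<longleftrightarrow> b)}. FM G k) = (\<Union>k\<in>{k. 0 < k \<and> (even k \<longleftrightarrow> b) \<and> k \<le> N}. FM G k)"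
proof (rule pair_set_eqI)
  fix u v
  show "{u, v} \<in> (\<Union>k\<in>{k. 0 < k \<and> (even k \<longleftrightarrow> b)}. FM G k) \<longleftrightarrow>
    {u, v} \<in> (\<Union>k\<in>{k. 0 < k \<and> (even k \<longleftrightarrow> b) \<and> k \<le> N}. FM G k)"
  proof
    assume "{u, v} \<in> (\<Union>k\<in>{k. 0 < k \<and> (even k \<longleftrightarrow> b)}. FM G k)"
    then obtain k where k: "min_joined G k u v" "even k \<longleftrightarrow> b" by (auto simp: mem_FM_iff)
    then obtain l where l: "l \<le> N" "min_joined G l u v"
      using cover[of u v] min_joined_verts[OF k(1)] by blast
    have "even l \<longleftrightarrow> b" using min_joined_parity[OF l(2) k(1)] k(2) by simp
    then show "{u, v} \<in> (\<Union>k\<in>{k. 0 < k \<and> (even k \<longleftrightarrow> b) \<and> k \<le> N}. FM G k)"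
      using l min_joined_pos[OF l(2)] by (auto simp: mem_FM_iff)
  qed auto
next
  fix e
  show "e \<in> (\<Union>k\<in>{k. 0 < k \<and> (even k \<longleftrightarrow> b)}. FM G k) \<Longrightarrow> \<exists>u v. e = {u, v}"
    using FM_pair by blast
  show "e \<in> (\<Union>k\<in>{k. 0 < k \<and> (even k \<longleftrightarrow> b) \<and> k \<le> N}. FM G k) \<Longrightarrow> \<exists>u v. e = {u, v}"
    using FM_pair by blast
qed

theorem FM_ev_stabilizes: "FM_ev_stabilizes_by G N"
  using FM_parity_stabilizes[of True] N_pos by (simp add: FM_ev_stabilizes_by_def FM_ev_def)

theorem FM_od_stabilizes: "FM_od_stabilizes_by G N"
  using FM_parity_stabilizes[of False] N_pos by (simp add: FM_od_stabilizes_by_def FM_od_def)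

theorem eventually_FM:
  "\<forall>\<^sub>F l in sequentially. FM_ev G = edges ((metamour ^^ (2 * l)) G) \<and>
     FM_od G = edges ((metamour ^^ (2 * l + 1)) G)"
  unfolding eventually_sequentially
proof (intro exI allI impI)
  fix l assume "N \<le> l"
  then show "FM_ev G = edges ((metamour ^^ (2 * l)) G) \<and> FM_od G = edges ((metamour ^^ (2 * l + 1)) G)"
    using edges_metamour_pow[of "2 * l"] edges_metamour_pow[of "2 * l + 1"] by simp
qed

theorem FM_union:
  assumes "\<And>e. e \<in> edges G \<Longrightarrow> \<exists>u \<in> verts G. \<exists>v \<in> verts G. e = {u, v}"
  shows "FM_ev G \<union> FM_od G = edges G \<union> edges (graph_complement G)"
proof (rule pair_set_eqI)
  fix u v
  have "{u, v} \<in> FM_ev G \<union> FM_od G \<longleftrightarrow> u \<in> verts G \<and> v \<in> verts G \<and> u \<noteq> v"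
    unfolding Un_iff mem_FM_ev_iff mem_FM_od_iff
    using cover[of u v] min_joined_verts[of G _ u v] by blast
  also have "\<dots> \<longleftrightarrow> {u, v} \<in> edges G \<union> edges (graph_complement G)"
    using assms[of "{u, v}"] edge_midpoint[of u v]
    by (auto simp: graph_complement_def doubleton_eq_iff insert_commute)
  finally show "{u, v} \<in> FM_ev G \<union> FM_od G \<longleftrightarrow> {u, v} \<in> edges G \<union> edges (graph_complement G)" .
next
  show "\<exists>u v. e = {u, v}" if "e \<in> FM_ev G \<union> FM_od G" for e
    using that FM_ev_pair FM_od_pair by blast
  show "\<exists>u v. e = {u, v}" if "e \<in> edges G \<union> edges (graph_complement G)" for e
    using that assms[of e] by (auto simp: graph_complement_def)
qed

end

section \<open>Shifts in the generalized Petersen graphs\<close>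

locale petersen_2 =
  fixes m :: nat
  assumes m5: "5 \<le> m"
begin

abbreviation P :: "pvertex ugraph" where "P \<equiv> gen_petersen m 2"

text \<open>
  Integer indices make shifts additive along walks. The flag is true for outer vertices.
\<close>

definition vtx :: "bool \<Rightarrow> int \<Rightarrow> pvertex" where
  "vtx s a = (if s then Outer else Inner) (nat (a mod int m))"

text \<open>
  The flags \<open>s\<close> and \<open>t\<close> are the types of the first and the second end, and \<open>d\<close> is the index of the
  second minus the index of the first. An edge is a pair with \<open>edge_shift\<close>, and the pairs at distance
  two have \<open>two_shift\<close>, by composition of edges.
\<close>

definition edge_shift :: "bool \<Rightarrow> bool \<Rightarrow> int \<Rightarrow> bool" where
  "edge_shift s t d \<longleftrightarrow> (if s \<noteq> t then d = 0 else if s then \<bar>d\<bar> = 1 else \<bar>d\<bar> = 2)"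

definition two_shift :: "bool \<Rightarrow> bool \<Rightarrow> int \<Rightarrow> bool" where
  "two_shift s t d \<longleftrightarrow> (if s \<noteq> t then \<bar>d\<bar> = 1 \<or> \<bar>d\<bar> = 2 else if s then \<bar>d\<bar> = 2 else \<bar>d\<bar> = 4)"

text \<open>
  The shifts that \<open>n \<ge> 4\<close> edges can achieve, \<open>n\<close> a power of two, with \<open>c = 2 * n - 4\<close>. A walk advances
  fastest, by two, on the edges between inner vertices, and every change of type costs an edge that
  does not advance. One change leaves \<open>2 * (n - 1) = c + 2\<close>, two leave \<open>2 * (n - 2) = c\<close>. A walk that
  stays on inner vertices reaches \<open>2 * n = c + 4\<close>, but then its shift is a multiple of \<open>4\<close>, so it is
  either exactly that or at most \<open>c\<close>.
\<close>

definition shift_bound :: "int \<Rightarrow> bool \<Rightarrow> bool \<Rightarrow> int \<Rightarrow> bool" where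
  "shift_bound c s t d \<longleftrightarrow>
     (if s \<noteq> t then \<bar>d\<bar> \<le> c + 2 else if s then \<bar>d\<bar> \<le> c else \<bar>d\<bar> \<le> c \<or> \<bar>d\<bar> = c + 4)"

text \<open>
  The nonnegative shifts up to \<open>m / 2\<close> that are within the bounds for \<open>2 * c + 4\<close> but not within
  those for \<open>c\<close>. Three details need care. The outer shift \<open>2\<close> satisfies the inequalities for
  \<open>c = 0\<close>, but it belongs to pairs at distance two. An inner shift \<open>d\<close> with \<open>d + c + 4 = m\<close> is
  congruent to \<open>- (c + 4)\<close>, which is not new. For the same reason the isolated inner shift
  \<open>2 * c + 8\<close> has to be available slightly beyond \<open>m / 2\<close>: for the next value \<open>2 * c + 4\<close> of \<open>c\<close>,
  an excluded \<open>d\<close> is congruent to \<open>- (2 * c + 8)\<close>, and \<open>d \<ge> 2 * c + 5\<close> only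
  gives \<open>2 * (2 * c + 8) \<le> m + 3\<close>.
\<close>

definition new_shift :: "int \<Rightarrow> bool \<Rightarrow> bool \<Rightarrow> int \<Rightarrow> bool" where
  "new_shift c s t d \<longleftrightarrow>
     (if s \<noteq> t then c + 2 < d \<and> d \<le> 2 * c + 6 \<and> 2 * d \<le> int m
      else if s then c < d \<and> d \<le> 2 * c + 4 \<and> d \<noteq> 2 \<and> 2 * d \<le> int m
      else c < d \<and> d \<le> 2 * c + 4 \<and> d \<noteq> c + 4 \<and> d + c + 4 \<noteq> int m \<and> 2 * d \<le> int m \<or>
           d = 2 * c + 8 \<and> 2 * d \<le> int m + 3)"

text \<open>
  The value of \<open>c\<close> for 2-walks of length \<open>k + 1\<close>; the new shifts for \<open>reach k\<close> are those of length
  \<open>k + 2\<close>. For \<open>k = 0\<close> the bounds do not describe the outer pairs at distance two, so length one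
  always gets separate treatment.
\<close>

definition reach :: "nat \<Rightarrow> int" where
  "reach k = 4 * 2 ^ k - 4"

lemma reach_0 [simp]: "reach 0 = 0"
  and reach_Suc: "reach (Suc k) = 2 * reach k + 4"
  by (simp_all add: reach_def)

lemma reach_nonneg: "0 \<le> reach k"
  and even_reach: "even (reach k)"
  by (simp_all add: reach_def)

lemma m_pos: "0 < m" "0 < int m"
  using m5 by simp_all

lemma vtx_eq_iff: "vtx s a = vtx t b \<longleftrightarrow> s = t \<and> int m dvd (a - b)"
proof -
  have "nat (a mod int m) = nat (b mod int m) \<longleftrightarrow> a mod int m = b mod int m"
    using m_pos by (metis nat_eq_iff2 pos_mod_sign int_nat_eq)
  then show ?thesis
    unfolding vtx_def mod_eq_dvd_iff[symmetric] by auto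
qed

lemma vtx_of_nat_mod: "vtx s (int i) = (if s then Outer else Inner) (i mod m)"
  by (simp add: vtx_def flip: zmod_int)

lemma vtx_of_nat: "i < m \<Longrightarrow> vtx s (int i) = (if s then Outer else Inner) i"
  by (simp add: vtx_of_nat_mod)

lemma vtx_in_verts: "vtx s a \<in> verts P"
proof -
  have "nat (a mod int m) < m" using m_pos by (simp add: nat_less_iff)
  then show ?thesis by (auto simp: vtx_def gen_petersen_def)
qed

lemma vertsE:
  assumes "v \<in> verts P"
  obtains s a where "v = vtx s a"
proof -
  from assms obtain i where "i < m" "v = Outer i \<or> v = Inner i"
    by (auto simp: gen_petersen_def)
  then show thesis
    using that[of True "int i"] that[of False "int i"] vtx_of_nat[of i] by auto
qed

text \<open>
  Any index may be replaced by its residue, as is needed to match it with the naturals in the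
  definition of the graph.
\<close>

lemma vtx_reduce: obtains i where "i < m" "\<And>s d. vtx s (a + d) = vtx s (int i + d)"
proof
  show "nat (a mod int m) < m" using m_pos by (simp add: nat_less_iff)
  show "vtx s (a + d) = vtx s (int (nat (a mod int m)) + d)" for s d
    using m_pos by (simp add: vtx_def mod_add_left_eq)
qed

lemma edge_generators:
  "{vtx True a, vtx True (a + 1)} \<in> edges P"
  "{vtx True a, vtx False a} \<in> edges P"
  "{vtx False a, vtx False (a + 2)} \<in> edges P"
proof -
  obtain i where i: "i < m" "\<And>s d. vtx s (a + d) = vtx s (int i + d)"
    by (rule vtx_reduce[where a = a]) blast
  have a0: "vtx s a = (if s then Outer else Inner) i" for s
    using i(2)[of s 0] vtx_of_nat[OF i(1)] by simp
  have "vtx True (a + 1) = Outer ((i + 1) mod m)"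
    using i(2)[of True 1] vtx_of_nat_mod[of True "i + 1"] by (simp add: add.commute)
  then show "{vtx True a, vtx True (a + 1)} \<in> edges P"
    using i(1) a0[of True] by (auto simp: gen_petersen_def)
  show "{vtx True a, vtx False a} \<in> edges P"
    using i(1) a0 by (auto simp: gen_petersen_def)
  have "vtx False (a + 2) = Inner ((i + 2) mod m)"
    using i(2)[of False 2] vtx_of_nat_mod[of False "i + 2"] by (simp add: add.commute)
  then show "{vtx False a, vtx False (a + 2)} \<in> edges P"
    using i(1) a0[of False] by (auto simp: gen_petersen_def)
qed

lemma edge_vtxI:
  assumes "edge_shift s t d"
  shows "{vtx s a, vtx t (a + d)} \<in> edges P"
proof -
  have "s \<noteq> t \<and> d = 0 \<or> s \<and> t \<and> (d = 1 \<or> d = - 1) \<or> \<not> s \<and> \<not> t \<and> (d = 2 \<or> d = - 2)"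
    using assms by (auto simp: edge_shift_def split: if_splits)
  then show ?thesis
    using edge_generators(1)[of a] edge_generators(1)[of "a - 1"] edge_generators(2)[of a]
      edge_generators(3)[of a] edge_generators(3)[of "a - 2"]
    by (elim disjE conjE) (simp_all add: insert_commute, cases s, simp_all add: insert_commute)
qed

lemma edgeE:
  assumes "e \<in> edges P"
  obtains s a t d where "e = {vtx s a, vtx t (a + d)}" "edge_shift s t d"
proof -
  from assms consider
      i where "i < m" "e = {Outer i, Outer ((i + 1) mod m)}"
    | i where "i < m" "e = {Outer i, Inner i}"
    | i where "i < m" "e = {Inner i, Inner ((i + 2) mod m)}"
    by (auto simp: gen_petersen_def)
  then show thesis
  proof cases
    case 1
    then show thesis
      using that[of True "int i" True 1] vtx_of_nat[of i True] vtx_of_nat_mod[of True "i + 1"]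
      by (simp add: edge_shift_def add.commute)
  next
    case 2
    then show thesis
      using that[of True "int i" False 0] vtx_of_nat[of i True] vtx_of_nat[of i False]
      by (simp add: edge_shift_def)
  next
    case 3
    then show thesis
      using that[of False "int i" False 2] vtx_of_nat[of i False] vtx_of_nat_mod[of False "i + 2"]
      by (simp add: edge_shift_def add.commute)
  qed
qed

lemma vtx_shift: "vtx s a = vtx s' a' \<Longrightarrow> vtx t (a + d) = vtx t (a' + d)"
  by (simp add: vtx_eq_iff)

lemma edge_vtxD:
  assumes "{vtx s a, v} \<in> edges P"
  shows "\<exists>t d. v = vtx t (a + d) \<and> edge_shift s t d"
proof -
  obtain s' a' t' d where e: "{vtx s a, v} = {vtx s' a', vtx t' (a' + d)}" "edge_shift s' t' d"
    by (rule edgeE[OF assms]) blast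
  then consider "vtx s a = vtx s' a'" "v = vtx t' (a' + d)" | "vtx s a = vtx t' (a' + d)" "v = vtx s' a'"
    by (auto simp: doubleton_eq_iff)
  then show ?thesis
  proof cases
    case 1
    have "s = s'" using 1(1) by (simp add: vtx_eq_iff)
    moreover have "v = vtx t' (a + d)" using vtx_shift[OF 1(1), of t' d] 1(2) by simp
    ultimately show ?thesis using e(2) by blast
  next
    case 2
    have "s = t'" using 2(1) by (simp add: vtx_eq_iff)
    moreover have "v = vtx s' (a + - d)" using vtx_shift[OF 2(1), of s' "- d"] 2(2) by simp
    moreover have "edge_shift t' s' (- d)" using e(2) by (auto simp: edge_shift_def)
    ultimately show ?thesis by blast
  qed
qed

lemma dvd_small:
  assumes "int m dvd x" "\<bar>x\<bar> < int m"
  shows "x = 0"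
proof (rule ccontr)
  assume "x \<noteq> 0"
  from dvd_imp_le_int[OF this assms(1)] assms(2) show False by simp
qed

lemma edge_neq:
  assumes "{u, v} \<in> edges P" "u \<in> verts P"
  shows "u \<noteq> v"
proof
  assume uv: "u = v"
  obtain s a where u: "u = vtx s a" using vertsE[OF assms(2)] .
  have "{vtx s a, vtx s a} \<in> edges P" using assms(1) uv u by simp
  from edge_vtxD[OF this] obtain t d where "vtx s a = vtx t (a + d)" "edge_shift s t d" by blast
  then show False
    using dvd_small[of d] m5 by (auto simp: vtx_eq_iff edge_shift_def split: if_splits)
qed

lemma joined_one_shift:
  assumes "joined P 1 (vtx s a) v"
  shows "\<exists>t d. v = vtx t (a + d) \<and> two_shift s t d"
proof -
  obtain x where x: "{vtx s a, x} \<in> edges P" "{x, v} \<in> edges P" "vtx s a \<noteq> v"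
    by (rule joined_oneE[OF assms])
  obtain r d where r: "x = vtx r (a + d)" "edge_shift s r d"
    using edge_vtxD[OF x(1)] by (elim exE conjE) (rule that)
  obtain t d' where t: "v = vtx t (a + d + d')" "edge_shift r t d'"
    using edge_vtxD[OF x(2)[unfolded r(1)]] by (elim exE conjE) (rule that)
  have "v = vtx t (a + (d + d'))" using t(1) by (simp add: add.assoc)
  then have "s = t \<longrightarrow> d + d' \<noteq> 0" using x(3) by auto
  then have "two_shift s t (d + d')"
    using r(2) t(2) by (cases s; cases r; cases t) (auto simp: edge_shift_def two_shift_def)
  then show ?thesis using t(1) by (intro exI[of _ t] exI[of _ "d + d'"]) (simp add: add.assoc)
qed

text \<open>
  All pairs with \<open>two_shift\<close> are at distance two unless they are adjacent by wrapping around, and for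
  \<open>m \<ge> 5\<close> this happens only to the inner shifts \<open>4\<close> and \<open>- 4\<close> when \<open>m = 6\<close>, as \<open>4\<close> is then
  congruent to \<open>- 2\<close>.
\<close>

lemma joined_oneI:
  assumes "two_shift s t d" and "s \<or> t \<or> m \<noteq> 6"
  shows "joined P 1 (vtx s a) (vtx t (a + d))"
proof -
  have neq: "vtx s a \<noteq> vtx t (a + d)"
    using dvd_small[of d] assms(1) m5 by (auto simp: vtx_eq_iff two_shift_def split: if_splits)
  have nonedge: "{vtx s a, vtx t (a + d)} \<notin> edges P"
  proof
    assume "{vtx s a, vtx t (a + d)} \<in> edges P"
    then obtain d' where d': "int m dvd d - d'" "edge_shift s t d'"
      using edge_vtxD by (fastforce simp: vtx_eq_iff)
    have nz: "d - d' \<noteq> 0" "\<bar>d - d'\<bar> \<le> 6"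
      using assms(1) d'(2) by (auto simp: edge_shift_def two_shift_def split: if_splits)
    have "\<bar>d - d'\<bar> \<le> 3 \<or> \<not> s \<and> \<not> t \<and> (\<bar>d - d'\<bar> = 2 \<or> \<bar>d - d'\<bar> = 6)"
      using assms(1) d'(2) by (auto simp: edge_shift_def two_shift_def split: if_splits)
    then have "\<bar>d - d'\<bar> = 6" "m \<noteq> 6"
      using dvd_small[OF d'(1)] nz m5 assms(2) by auto
    then have "int m dvd 6" using d'(1) by (metis dvd_abs_iff)
    moreover have "m = 5" using dvd_small[OF d'(1)] \<open>\<bar>d - d'\<bar> = 6\<close> \<open>m \<noteq> 6\<close> m5 nz(1) by linarith
    ultimately show False by simp
  qed
  have "\<exists>r d1 d2. d = d1 + d2 \<and> edge_shift s r d1 \<and> edge_shift r t d2"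
  proof (cases "s = t")
    case True
    then have "s \<and> (d = 2 \<or> d = - 2) \<or> \<not> s \<and> (d = 4 \<or> d = - 4)"
      using assms(1) by (auto simp: two_shift_def split: if_splits)
    then have "d = d div 2 + d div 2" "edge_shift s s (d div 2)"
      by (auto simp: edge_shift_def)
    then show ?thesis using True by blast
  next
    case False
    then have "edge_shift s s d \<and> edge_shift s t 0 \<or> edge_shift s t 0 \<and> edge_shift t t d"
      using assms(1) by (auto simp: edge_shift_def two_shift_def)
    then show ?thesis by (metis add.right_neutral add.left_neutral)
  qed
  then obtain r d1 d2 where d: "d = d1 + d2" "edge_shift s r d1" "edge_shift r t d2" by blast
  have e: "{vtx s a, vtx r (a + d1)} \<in> edges P" "{vtx r (a + d1), vtx t (a + d)} \<in> edges P"
    using edge_vtxI[OF d(2), of a] edge_vtxI[OF d(3), of "a + d1"] d(1) by (auto simp: add.assoc)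
  then have "vtx r (a + d1) \<noteq> vtx s a" "vtx r (a + d1) \<noteq> vtx t (a + d)"
    using edge_neq[OF e(1) vtx_in_verts] edge_neq[OF e(2) vtx_in_verts] by simp_all
  then show ?thesis
    unfolding joined_one using neq nonedge e vtx_in_verts by blast
qed

text \<open>
  The witness is the vertex opposite to the edge in the pentagon formed by three consecutive outer
  vertices and the two inner vertices attached to the outermost of them, or a rotated or reflected
  copy of it. It is always reached by a shift between vertices that are not both inner, so \<open>m = 6\<close>
  is no exception.
\<close>

sublocale metamour_midpoint_graph P
proof
  fix u v
  assume uv: "{u, v} \<in> edges P" "u \<in> verts P" "v \<in> verts P"
  obtain s a where u: "u = vtx s a" using vertsE[OF uv(2)] .
  obtain t d where v: "v = vtx t (a + d)" "edge_shift s t d"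
    using edge_vtxD[OF uv(1)[unfolded u]] by (elim exE conjE) (rule that)
  have "\<exists>r d1 d2. d = d1 + d2 \<and> two_shift s r d1 \<and> two_shift r t d2 \<and> (s \<or> r) \<and> (r \<or> t)"
  proof (cases "s = t")
    case True
    show ?thesis
    proof (cases s)
      case True
      then have "d = 2 * d + - d" "two_shift s False (2 * d)" "two_shift False t (- d)"
        using v(2) \<open>s = t\<close> by (auto simp: edge_shift_def two_shift_def)
      then show ?thesis using True \<open>s = t\<close> by blast
    next
      case False
      then have "d = 2 \<or> d = - 2"
        using v(2) \<open>s = t\<close> by (auto simp: edge_shift_def)
      then have "d = d div 2 + d div 2" "two_shift s True (d div 2)" "two_shift True t (d div 2)"
        using False \<open>s = t\<close> by (auto simp: two_shift_def)
      then show ?thesis by blast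
    qed
  next
    case False
    then have "d = 2 + - 2" "two_shift s True 2" "two_shift True t (- 2)"
      using v(2) by (auto simp: edge_shift_def two_shift_def)
    then show ?thesis by blast
  qed
  then obtain r d1 d2 where d: "d = d1 + d2" "two_shift s r d1" "two_shift r t d2" "s \<or> r" "r \<or> t"
    by blast
  have "joined P 1 u (vtx r (a + d1))" "joined P 1 (vtx r (a + d1)) v"
    using joined_oneI[OF d(2), of a] joined_oneI[OF d(3), of "a + d1"] d u v(1) by (auto simp: add.assoc)
  then show "u \<noteq> v \<and> (\<exists>x. joined P 1 u x \<and> joined P 1 x v)"
    using edge_neq[OF uv(1,2)] by blast
qed

section \<open>New shifts are fully minimal\<close>

lemma joined_shift_bound:
  "joined P (Suc (Suc k)) (vtx s a) v \<Longrightarrow>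
     \<exists>t d. v = vtx t (a + d) \<and> shift_bound (reach (Suc k)) s t d"
proof (induction k arbitrary: s a v)
  case 0
  then obtain x where x: "joined P 1 (vtx s a) x" "joined P 1 x v"
    using joined_Suc[of 1 P] by auto
  obtain r d where r: "x = vtx r (a + d)" "two_shift s r d"
    using joined_one_shift[OF x(1)] by (elim exE conjE) (rule that)
  obtain t d' where t: "v = vtx t (a + d + d')" "two_shift r t d'"
    using joined_one_shift[OF x(2)[unfolded r(1)]] by (elim exE conjE) (rule that)
  have "shift_bound 4 s t (d + d')"
    using r(2) t(2) by (cases s; cases r; cases t) (auto simp: shift_bound_def two_shift_def)
  then show ?case using t(1) by (auto simp: reach_Suc add.assoc)
next
  case (Suc k)
  let ?c = "reach (Suc k)"
  obtain x where x: "joined P (Suc (Suc k)) (vtx s a) x" "joined P (Suc (Suc k)) x v"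
    using joined_Suc[of "Suc (Suc k)" P] Suc.prems by blast
  obtain r d where r: "x = vtx r (a + d)" "shift_bound ?c s r d"
    using Suc.IH[OF x(1)] by (elim exE conjE) (rule that)
  obtain t d' where t: "v = vtx t (a + d + d')" "shift_bound ?c r t d'"
    using Suc.IH[OF x(2)[unfolded r(1)]] by (elim exE conjE) (rule that)
  have "shift_bound (2 * ?c + 4) s t (d + d')"
    using r(2) t(2) reach_nonneg[of "Suc k"]
    by (cases s; cases r; cases t) (auto simp: shift_bound_def)
  then show ?case using t(1) by (auto simp: reach_Suc[of "Suc k"] add.assoc)
qed

text \<open>
  Ends of the same type: the shifts from \<open>2 * c + 6\<close> to \<open>4 * c + 12\<close> are sums of two mixed shifts
  through a vertex of the other type, the smallest new shift \<open>2 * c + 5\<close> is a sum of two shifts of the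
  same type, and the isolated inner shift is twice the previous one. Mixed ends: shifts through an outer vertex reach \<open>4 * c + 10\<close>, and the
  last four need the isolated inner shift \<open>2 * c + 8\<close>. Evenness of \<open>c\<close> keeps the summand
  \<open>c + 1\<close> away from the outer shift \<open>2\<close>.
\<close>

lemma new_shift_split:
  assumes "0 \<le> c" and "even c" and "new_shift (2 * c + 4) s t d"
  shows "\<exists>r d1 d2. d = d1 + d2 \<and> new_shift c s r d1 \<and> new_shift c r t d2"
proof -
  have split: ?thesis if "new_shift c s r d1" "new_shift c r t (d - d1)" for r d1
    using that by (metis add_diff_cancel_left' add_diff_eq add.commute diff_add_cancel)
  show ?thesis
  proof (cases "s = t")
    case True
    have "2 * c + 5 \<le> d \<and> d \<le> 4 * c + 12 \<and> 2 * d \<le> int m \<or> \<not> s \<and> d = 4 * c + 16"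
      using assms True by (auto simp: new_shift_def split: if_splits)
    moreover have "d = 2 * c + 5 \<or> d < 2 * c + 5 \<or> 2 * c + 6 \<le> d \<and> d \<le> 3 * c + 9 \<or> 3 * c + 9 < d"
      by linarith
    ultimately consider "s" "d = 2 * c + 5" | "\<not> s" "d = 2 * c + 5" | "\<not> s" "d = 4 * c + 16"
      | "2 * c + 6 \<le> d" "d \<le> 3 * c + 9" "2 * d \<le> int m" | "3 * c + 9 < d" "d \<le> 4 * c + 12" "2 * d \<le> int m"
      by (meson not_le)
    then show ?thesis
    proof cases
      case 1
      then show ?thesis using assms True by (intro split[of True "c + 1"]) (auto simp: new_shift_def)
    next
      case 2
      then show ?thesis using assms True by (intro split[of False "c + 2"]) (auto simp: new_shift_def)
    next
      case 3
      then show ?thesis using assms True by (intro split[of False "2 * c + 8"]) (auto simp: new_shift_def)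
    next
      case 4
      then show ?thesis using assms True by (intro split[of "\<not> s" "c + 3"]) (auto simp: new_shift_def)
    next
      case 5
      then show ?thesis using assms True by (intro split[of "\<not> s" "2 * c + 6"]) (auto simp: new_shift_def)
    qed
  next
    case False
    then have d: "2 * c + 6 < d" "d \<le> 4 * c + 14" "2 * d \<le> int m"
      using assms by (auto simp: new_shift_def)
    then consider "d \<le> 3 * c + 9" | "3 * c + 9 < d" "d \<le> 4 * c + 10" | "4 * c + 10 < d" by linarith
    then show ?thesis
    proof cases
      case 1
      then show ?thesis using assms False d
        by (cases s; intro split[of True "if s then c + 3 else d - (c + 3)"]) (auto simp: new_shift_def)
    next
      case 2
      then show ?thesis using assms False d
        by (cases s; intro split[of True "if s then 2 * c + 4 else d - (2 * c + 4)"]) (auto simp: new_shift_def)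
    next
      case 3
      then show ?thesis using assms False d
        by (cases s; intro split[of False "if s then d - (2 * c + 8) else 2 * c + 8"]) (auto simp: new_shift_def)
    qed
  qed
qed

text \<open>
  The conditions on \<open>m \<noteq> 6\<close> are those of \<open>joined_oneI\<close>: the summand \<open>4\<close> between inner vertices is
  used only for shifts \<open>d \<ge> 5\<close>, where \<open>m\<close> is at least \<open>10\<close>.
\<close>

lemma new_shift_0_split:
  assumes "new_shift 0 s t d"
  shows "\<exists>r d1 d2. d = d1 + d2 \<and> two_shift s r d1 \<and> two_shift r t d2 \<and>
     (s \<or> r \<or> m \<noteq> 6) \<and> (r \<or> t \<or> m \<noteq> 6)"
proof -
  have split: ?thesis if "two_shift s r d1" "two_shift r t (d - d1)"
    "s \<or> r \<or> m \<noteq> 6" "r \<or> t \<or> m \<noteq> 6" for r d1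
    using that by (metis add_diff_cancel_left' add_diff_eq add.commute diff_add_cancel)
  show ?thesis
  proof (cases "s = t")
    case True
    consider "s" "d = 1 \<or> d = 3" | "s" "d = 4" | "\<not> s" "d = 1 \<or> d = 2 \<or> d = 3" | "\<not> s" "d = 8" "m \<noteq> 6"
    proof -
      have "s \<and> 0 < d \<and> d \<le> 4 \<and> d \<noteq> 2 \<or> \<not> s \<and> (0 < d \<and> d < 4 \<or> d = 8 \<and> m \<noteq> 6)"
        using assms True by (auto simp: new_shift_def split: if_splits)
      then show thesis using that by fastforce
    qed
    then show ?thesis
    proof cases
      case 1
      then show ?thesis using True by (intro split[of False 2]) (auto simp: two_shift_def)
    next
      case 2
      then show ?thesis using True by (intro split[of True 2]) (auto simp: two_shift_def)
    next
      case 3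
      then show ?thesis using True
        by (intro split[of True "if d = 2 then 1 else 2"]) (auto simp: two_shift_def)
    next
      case 4
      then show ?thesis using True by (intro split[of False 4]) (auto simp: two_shift_def)
    qed
  next
    case False
    consider "d = 3 \<or> d = 4" | "d = 5 \<or> d = 6" "m \<noteq> 6"
    proof -
      have "2 < d \<and> d \<le> 6 \<and> 2 * d \<le> int m" using assms False by (simp add: new_shift_def)
      then have "d = 3 \<or> d = 4 \<or> (d = 5 \<or> d = 6) \<and> m \<noteq> 6" by auto
      then show thesis using that by blast
    qed
    then show ?thesis
    proof cases
      case 1
      then show ?thesis using False
        by (intro split[of True "if s then 2 else d - 2"]) (auto simp: two_shift_def)
    next
      case 2
      then show ?thesis using False
        by (intro split[of False "if s then d - 4 else 4"]) (auto simp: two_shift_def)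
    qed
  qed
qed

text \<open>
  A shift in the lower half of the residues has no shorter representative, and at most one further
  representative that is not much longer.
\<close>

lemma dvd_shift_cases:
  assumes "int m dvd d - d'" "0 \<le> d" "\<bar>d'\<bar> \<le> d + 3" "2 * d \<le> int m"
  shows "d' = d \<or> d' = d - int m"
proof (rule ccontr)
  assume A: "\<not> ?thesis"
  have "\<not> \<bar>d - d'\<bar> < int m" using A dvd_small[OF assms(1)] by auto
  moreover have "5 \<le> int m" using m5 by simp
  ultimately have "\<bar>d - d' - int m\<bar> < int m" using assms(2-4) by linarith
  moreover have "int m dvd d - d' - int m" using assms(1) by simp
  ultimately have "d - d' - int m = 0" by (intro dvd_small)
  then show False using A by simp
qed

lemma new_shift_not_bounded:
  assumes "4 \<le> c" "new_shift c s t d" "shift_bound c s t d'" "int m dvd d - d'"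
  shows False
proof (cases "2 * d \<le> int m")
  case True
  have "0 \<le> d" "\<bar>d'\<bar> \<le> d + 3"
    using assms by (auto simp: new_shift_def shift_bound_def split: if_splits)
  with dvd_shift_cases[OF assms(4)] True have "d' = d \<or> d' = d - int m" by blast
  then show False
    using assms by (auto simp: new_shift_def shift_bound_def split: if_splits)
next
  case False
  then have d: "d = 2 * c + 8" "2 * d \<le> int m + 3" "\<bar>d'\<bar> \<le> c + 4"
    using assms by (auto simp: new_shift_def shift_bound_def split: if_splits)
  then have "d - d' = 0"
    using assms(1) by (intro dvd_small assms(4)) auto
  then show False using d assms(1) by auto
qed

lemma new_shift_0_not_two_shift:
  assumes "new_shift 0 s t d" "two_shift s t d'" "int m dvd d - d'"
  shows False
proof (cases "2 * d \<le> int m")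
  case True
  have "0 \<le> d" "\<bar>d'\<bar> \<le> d + 3"
    using assms by (auto simp: new_shift_def two_shift_def split: if_splits)
  with dvd_shift_cases[OF assms(3)] True have "d' = d \<or> d' = d - int m" by blast
  then show False
    using assms m5 by (auto simp: new_shift_def two_shift_def split: if_splits)
next
  case False
  then have d: "d = 8" "2 * d \<le> int m + 3" "\<bar>d'\<bar> = 4"
    using assms by (auto simp: new_shift_def two_shift_def split: if_splits)
  then have "d - d' = 0"
    by (intro dvd_small assms(3)) auto
  then show False using d by auto
qed

lemma new_shift_neq:
  assumes "0 \<le> c" "new_shift c s t d"
  shows "vtx s a \<noteq> vtx t (a + d)"
proof
  assume "vtx s a = vtx t (a + d)"
  then have st: "s = t" and dvd: "int m dvd d" by (auto simp: vtx_eq_iff)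
  have "0 < d" "d < int m"
    using assms st m5 by (auto simp: new_shift_def split: if_splits)
  then show False using dvd_small[OF dvd] by auto
qed

text \<open>
  The summands give the two fully minimal halves, and the bound on shifts of shorter 2-walks gives
  the minimality of the whole.
\<close>

lemma min_joined_new_shift:
  "new_shift (reach k) s t d \<Longrightarrow> min_joined P (Suc (Suc k)) (vtx s a) (vtx t (a + d))"
proof (induction k arbitrary: s t d a)
  case 0
  then have new: "new_shift 0 s t d" by simp
  obtain r d1 d2 where d: "d = d1 + d2" "two_shift s r d1" "two_shift r t d2"
    "s \<or> r \<or> m \<noteq> 6" "r \<or> t \<or> m \<noteq> 6"
    using new_shift_0_split[OF new] by blast
  have "min_joined P 1 (vtx s a) (vtx r (a + d1))" "min_joined P 1 (vtx r (a + d1)) (vtx t (a + d))"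
    unfolding min_joined_one
    using joined_oneI[OF d(2,4), of a] joined_oneI[OF d(3,5), of "a + d1"] d(1)
    by (simp_all add: add.assoc)
  moreover have "\<not> joined P 1 (vtx s a) (vtx t (a + d))"
  proof
    assume "joined P 1 (vtx s a) (vtx t (a + d))"
    then obtain d' where "int m dvd d - d'" "two_shift s t d'"
      using joined_one_shift by (fastforce simp: vtx_eq_iff)
    then show False using new_shift_0_not_two_shift[OF new] by blast
  qed
  moreover have "vtx s a \<noteq> vtx t (a + d)"
    using new_shift_neq[OF _ new] by simp
  ultimately show ?case
    using min_joined_Suc[of 1 P "vtx s a" "vtx t (a + d)"] by auto
next
  case (Suc k)
  have new: "new_shift (2 * reach k + 4) s t d" using Suc.prems by (simp add: reach_Suc)
  obtain r d1 d2 where d: "d = d1 + d2" "new_shift (reach k) s r d1" "new_shift (reach k) r t d2"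
    using new_shift_split[OF reach_nonneg even_reach new] by blast
  have "min_joined P (Suc (Suc k)) (vtx s a) (vtx r (a + d1))"
    "min_joined P (Suc (Suc k)) (vtx r (a + d1)) (vtx t (a + d))"
    using Suc.IH[OF d(2), of a] Suc.IH[OF d(3), of "a + d1"] d(1) by (auto simp: add.assoc)
  moreover have "\<not> joined P (Suc (Suc k)) (vtx s a) (vtx t (a + d))"
  proof
    assume "joined P (Suc (Suc k)) (vtx s a) (vtx t (a + d))"
    then obtain d' where "int m dvd d - d'" "shift_bound (reach (Suc k)) s t d'"
      using joined_shift_bound[of k s a "vtx t (a + d)"] by (fastforce simp: vtx_eq_iff)
    moreover have "4 \<le> 2 * reach k + 4" using reach_nonneg[of k] by simp
    ultimately show False using new_shift_not_bounded new unfolding reach_Suc by blast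
  qed
  moreover have "vtx s a \<noteq> vtx t (a + d)"
    using new_shift_neq[OF _ new] reach_nonneg[of k] by simp
  ultimately show ?case
    using min_joined_Suc[of "Suc (Suc k)" P "vtx s a" "vtx t (a + d)"] by blast
qed

text \<open>
  Adjacent vertices are not at distance two, so a common metamour is the middle of a fully minimal
  2-walk. This covers the mixed shift \<open>0\<close> and, for \<open>m = 6\<close>, the inner shift \<open>2\<close>, which are not
  among the new shifts.
\<close>

lemma min_joined_edge: "edge_shift s t d \<Longrightarrow> min_joined P 2 (vtx s a) (vtx t (a + d))"
proof -
  assume "edge_shift s t d"
  then have e: "{vtx s a, vtx t (a + d)} \<in> edges P" by (rule edge_vtxI)
  then have "\<not> joined P 1 (vtx s a) (vtx t (a + d))" unfolding joined_one by simp
  then have "min_joined P (Suc 1) (vtx s a) (vtx t (a + d))"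
    using edge_midpoint[OF e vtx_in_verts vtx_in_verts]
    unfolding min_joined_Suc[of 1 P, OF zero_less_one] min_joined_one by blast
  then show ?thesis by (simp add: numeral_2_eq_2)
qed

section \<open>Every pair is fully minimal\<close>

lemma reach_bracket:
  assumes "0 < d"
  obtains k where "reach k < d" "d \<le> 2 * reach k + 4"
proof -
  define k where "k = (LEAST k. d \<le> reach (Suc k))"
  have "d \<le> reach (Suc (nat d))"
  proof -
    have "nat d < 2 ^ nat d" by (rule less_exp)
    then have "d < 2 ^ nat d" using assms by (metis int_nat_eq of_nat_less_iff of_nat_numeral of_nat_power order_less_le)
    then show ?thesis using assms by (simp add: reach_def)
  qed
  then have "d \<le> reach (Suc k)" unfolding k_def by (rule LeastI)
  moreover have "reach k < d"
  proof (cases k)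
    case 0
    then show ?thesis using assms by simp
  next
    case (Suc k')
    then show ?thesis using not_less_Least[of k' "\<lambda>k. d \<le> reach (Suc k)"] k_def by auto
  qed
  ultimately show thesis using that by (simp add: reach_Suc)
qed

text \<open>
  The level grows like the logarithm of \<open>m\<close>, so the linear bound is generous; it is tight only for
  \<open>m = 5\<close>, where even lengths need the value \<open>2\<close>.
\<close>

lemma reach_level_bound:
  assumes "2 * reach k < int m"
  shows "Suc (Suc k) \<le> (if m = 5 then 2 else 2 * (m div 2) + m - 8)"
proof (cases k)
  case 0
  then show ?thesis using m5 by auto
next
  case (Suc k')
  have "Suc k' < 2 ^ Suc k'" by (rule less_exp)
  then have "int k < int (2 ^ k)" unfolding Suc of_nat_less_iff .
  moreover have "reach k = 4 * int (2 ^ k) - 4" by (simp add: reach_def)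
  ultimately have "8 * k < m" using assms by linarith
  then show ?thesis using Suc by auto
qed

text \<open>
  A shift lies between two consecutive values of \<open>reach\<close> and is then new, apart from small shifts
  and two kinds of inner shift. The shift \<open>reach k + 4\<close> is the isolated new shift of the level
  before. The shift congruent to \<open>- (reach k + 4)\<close> is handled by the same isolated shift, walked
  in the opposite direction from the other end. For \<open>k = 0\<close> both are the shift \<open>4\<close> of inner vertices
  at distance two, unless \<open>m = 6\<close>, where they are adjacent.
\<close>

lemma min_joined_within:
  assumes "0 \<le> d" "2 * d \<le> int m" "s \<noteq> t \<or> d \<noteq> 0"
  shows "\<exists>k \<le> (if m = 5 then 2 else 2 * (m div 2) + m - 8). min_joined P k (vtx s a) (vtx t (a + d))"
    (is "\<exists>k \<le> ?N. ?J k")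
proof -
  have N: "1 \<le> ?N" "2 \<le> ?N" using m5 by auto
  have new: ?thesis if "new_shift (reach k) s t d" "reach k < d" for k
  proof -
    have "2 * reach k < int m" using that(2) assms(2) by simp
    then show ?thesis
      using min_joined_new_shift[OF that(1), of a] reach_level_bound by blast
  qed
  have two: ?thesis if "two_shift s t d" "s \<or> t \<or> m \<noteq> 6"
    using joined_oneI[OF that, of a] N(1) unfolding min_joined_one[symmetric] by blast
  have edge: ?thesis if "edge_shift s t d"
    using min_joined_edge[OF that, of a] N(2) by blast
  show ?thesis
  proof (cases "s = t")
    case False
    show ?thesis
    proof (cases "d \<le> 2")
      case True
      then have "d = 0 \<or> d = 1 \<or> d = 2" using assms(1) by auto
      then show ?thesis using two edge False by (auto simp: two_shift_def edge_shift_def)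
    next
      case d: False
      then obtain k where "reach k < d - 2" "d - 2 \<le> 2 * reach k + 4"
        using reach_bracket[of "d - 2"] by auto
      then show ?thesis using new[of k] False assms(2) by (simp add: new_shift_def)
    qed
  next
    case True
    then have pos: "0 < d" using assms by auto
    obtain k where k: "reach k < d" "d \<le> 2 * reach k + 4"
      using reach_bracket[OF pos] by blast
    show ?thesis
    proof (cases s)
      case s: True
      show ?thesis
      proof (cases "d = 2")
        case True
        then show ?thesis using two \<open>s = t\<close> s by (simp add: two_shift_def)
      next
        case False
        then show ?thesis using new[OF _ k(1)] k assms(2) \<open>s = t\<close> s by (simp add: new_shift_def)
      qed
    next
      case s: False
      consider "d \<noteq> reach k + 4" "d + reach k + 4 \<noteq> int m" | "d = reach k + 4" | "d + reach k + 4 = int m"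
        by blast
      then show ?thesis
      proof cases
        case 1
        then show ?thesis using new[OF _ k(1)] k assms(2) \<open>s = t\<close> s by (simp add: new_shift_def)
      next
        case 2
        show ?thesis
        proof (cases k)
          case 0
          then show ?thesis using 2 two assms(2) \<open>s = t\<close> s by (auto simp: two_shift_def)
        next
          case (Suc k')
          then show ?thesis using 2 new[of k'] reach_nonneg[of k'] assms(2) \<open>s = t\<close> s
            by (simp add: new_shift_def reach_Suc)
        qed
      next
        case 3
        have wrap: "vtx t (a + d) = vtx t (a + d - int m)"
          by (simp add: vtx_eq_iff)
        show ?thesis
        proof (cases k)
          case 0
          show ?thesis
          proof (cases "m = 6")
            case True
            then show ?thesis using 0 3 edge \<open>s = t\<close> s by (simp add: edge_shift_def)
          next
            case False
            have "d - int m = - 4" using 0 3 by simp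
            then have "two_shift s t (d - int m)" using \<open>s = t\<close> s by (simp add: two_shift_def)
            from joined_oneI[OF this, of a] False have "min_joined P 1 (vtx s a) (vtx t (a + d))"
              unfolding min_joined_one wrap by (simp add: add_diff_eq)
            then show ?thesis using N(1) by blast
          qed
        next
          case (Suc k')
          \<comment> \<open>\<open>e\<close> is the isolated new shift of level \<open>k'\<close>; it may exceed \<open>m / 2\<close> by up to \<open>3/2\<close>.\<close>
          define e where "e = int m - d"
          have e: "e = 2 * reach k' + 8" using Suc 3 by (simp add: e_def reach_Suc)
          have "2 * e \<le> int m + 3" using e k Suc 3 by (simp add: reach_Suc)
          then have "new_shift (reach k') t s e" using e \<open>s = t\<close> s by (simp add: new_shift_def)
          from min_joined_sym[OF min_joined_new_shift[OF this, of "a + d"]]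
          have "min_joined P (Suc (Suc k')) (vtx s (a + d + e)) (vtx t (a + d))" .
          moreover have "vtx s (a + d + e) = vtx s a" by (simp add: vtx_eq_iff e_def)
          moreover have "2 * reach k' < int m" using k Suc assms(2) reach_nonneg[of k'] by (simp add: reach_Suc)
          then have "Suc (Suc k') \<le> ?N" by (rule reach_level_bound)
          ultimately show ?thesis by metis
        qed
      qed
    qed
  qed
qed

sublocale minimally_covered_graph P "if m = 5 then 2 else 2 * (m div 2) + m - 8"
proof
  have "vtx True 0 \<noteq> vtx False 0" by (simp add: vtx_eq_iff)
  then show "\<exists>u \<in> verts P. \<exists>v \<in> verts P. u \<noteq> v" by (intro bexI[OF _ vtx_in_verts])
next
  fix u v
  assume uv: "u \<in> verts P" "v \<in> verts P" "u \<noteq> v"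
  obtain s a where u: "u = vtx s a" using vertsE[OF uv(1)] .
  obtain t b where v: "v = vtx t b" using vertsE[OF uv(2)] .
  define d where "d = (b - a) mod int m"
  have d: "0 \<le> d" "d < int m" using m_pos by (simp_all add: d_def)
  have v': "v = vtx t (a + d)"
    unfolding v vtx_eq_iff mod_eq_dvd_iff[symmetric] d_def by (simp add: mod_add_right_eq)
  have nz: "s \<noteq> t \<or> d \<noteq> 0" 
  proof (rule ccontr)
    assume "\<not> ?thesis"
    then have "s = t" "d = 0" by simp_all
    then have "u = v" unfolding u v' by simp
    with uv(3) show False by blast
  qed
  show "\<exists>k. k \<le> (if m = 5 then 2 else 2 * (m div 2) + m - 8) \<and> min_joined P k u v"
  proof (cases "2 * d \<le> int m")
    case True
    show ?thesis unfolding u v' by (rule min_joined_within[OF d(1) True nz])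
  next
    case False
    have wrap: "vtx s (a + d + (int m - d)) = u" unfolding u by (simp add: vtx_eq_iff)
    have "0 \<le> int m - d" "2 * (int m - d) \<le> int m" "t \<noteq> s \<or> int m - d \<noteq> 0"
      using d False by auto
    from min_joined_within[OF this, of "a + d"] obtain k where
      k: "k \<le> (if m = 5 then 2 else 2 * (m div 2) + m - 8)" "min_joined P k v u"
      unfolding wrap v'[symmetric] by (elim exE conjE) (rule that)
    show ?thesis
      by (intro exI conjI) (rule k(1), rule min_joined_sym[OF k(2)])
  qed
qed

text \<open>
  For \<open>m = 5\<close> the bound is \<open>1\<close> instead of \<open>2\<close>, which makes no difference for odd lengths.
\<close>

lemma FM_od_stabilizes_bound: "FM_od_stabilizes_by P (2 * (m div 2) + m - 8)"
proof (cases "m = 5")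
  case True
  have "{k. 0 < k \<and> odd k \<and> k \<le> (2::nat)} = {k. 0 < k \<and> odd k \<and> k \<le> 1}"
    by (auto simp: le_Suc_eq numeral_2_eq_2)
  then show ?thesis
    using FM_od_stabilizes True by (simp add: FM_od_stabilizes_by_def)
next
  case False
  then show ?thesis using FM_od_stabilizes by simp
qed

lemma edges_within:
  assumes "e \<in> edges P"
  shows "\<exists>u \<in> verts P. \<exists>v \<in> verts P. e = {u, v}"
proof -
  obtain s a t d where "e = {vtx s a, vtx t (a + d)}" by (rule edgeE[OF assms])
  then show ?thesis by (intro bexI[OF _ vtx_in_verts])
qed

end

theorem theorem8p10:
  fixes m :: nat
  assumes "m \<ge> 5"
  shows "has_metamour_limit_period (gen_petersen m 2) 2 \<and>
         is_metamour_limit_set (gen_petersen m 2)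
           {(verts (gen_petersen m 2), FM_ev (gen_petersen m 2)),
            (verts (gen_petersen m 2), FM_od (gen_petersen m 2))} \<and>
         FM_ev_stabilizes_by (gen_petersen m 2) (if m = 5 then 2 else 2 * (m div 2) + m - 8) \<and>
         FM_od_stabilizes_by (gen_petersen m 2) (2 * (m div 2) + m - 8) \<and>
         (\<forall>\<^sub>F l in sequentially.
           FM_ev (gen_petersen m 2) = edges ((metamour ^^ (2 * l)) (gen_petersen m 2)) \<and>
           FM_od (gen_petersen m 2) = edges ((metamour ^^ (2 * l + 1)) (gen_petersen m 2))) \<and>
         FM_ev (gen_petersen m 2) \<union> FM_od (gen_petersen m 2) =
           edges (gen_petersen m 2) \<union> edges (graph_complement (gen_petersen m 2))"
proof -
  interpret petersen_2 m by unfold_locales (rule assms)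
  show ?thesis
    by (intro conjI limit_period limit_set FM_ev_stabilizes FM_od_stabilizes_bound eventually_FM
        FM_union edges_within)
qed

end
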